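(* For the flat cross-ratio dynamics, there is a scaling symmetry $\rho$ that acts both on the cross-ratio coordinates $c_i$ and on the discrete curvature $\alpha_i$, in the following way: $$\alpha_i(t)=1+\kappa_i(t\alpha_1-1),\qquad c_i(t)=c_i\frac{\alpha_i(t)}{\alpha_i},\qquad\text{where }\kappa_i=\frac{\alpha_i-1}{\alpha_1-1}.$$ It is well defined for $t\neq\frac{1}{\alpha_1},\ \frac{\kappa_i-1}{\kappa_i\alpha_1}$ (for all $i$).
   Context: Let $F$ be a field, $\mathbb{P}^1=\mathbb{P}^1(F)$, $\mathrm{PGL}_2=\mathrm{GL}_2(F)/F^*$, $\mathbb{G}_m=F^*$ (as algebraic group), $n\geq3$. For four points of $\mathbb{P}^1$, $[a,b,c,d]=\frac{a-c}{a-d}\cdot\frac{b-d}{b-c}$. A (twisted) $n$-gon in $\mathbb{P}^1$ is $P=((p_i)_{i\in\mathbb{Z}},M)$ with monodromy $M\in\mathrm{PGL}_2$, $p_{i+n}=Mp_i$, with $p_i,p_{i+1},p_{i+2}$ pairwise distinct for all $i$. $\mathrm{PGL}_2$ acts by $A\cdot P=((Ap_i),AMA^{-1})$, with quotient the moduli space $\mathcal T_n$. The cross-ratio coordinates $c_i=[p_i,p_{i+1},p_{i-1},p_{i+2}]$ ($n$-periodic) determine the class $[P]$. Flat cross-ratio dynamics: $n$-gons are enriched with a discrete curvature, an $n$-periodic sequence $\alpha=(\alpha_i)$ with $\alpha_i\in\mathbb{G}_m\setminus\{1\}$, unchanged by $\mathrm{PGL}_2$. Two $n$-gons $P,Q$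 are $\alpha$-related, $P\overset{\alpha}{\sim}Q$, if they have the same monodromy, the same discrete curvature $\alpha$, and $[p_i,p_{i+1},q_i,q_{i+1}]=\alpha_i$ for all $i\in\mathbb{Z}$. For an $n$-gon $P$ there are generically exactly two $n$-gons $Q^+,Q^-$ that are $\alpha$-related to it; this gives the evolution operator in the future/past, called the flat cross-ratio dynamics. A scaling symmetry is a non-trivial action of the algebraic group $\mathbb{G}_m$ (possibly undefined for some values of $t$) on the moduli space, here on pairs $([P],\alpha)$ in the coordinates $(c,\alpha)$, which commutes with the dynamic: if $P\overset{\alpha}{\sim}Q$, then the deformed classes at $t$ of $(P,\alpha)$ and $(Q,\alpha)$ are represented by polygons $P_t,Q_t$ with $P_t\overset{\alpha(t)}{\sim}Q_t$.
   Formalization: Non-triviality of the action (on points over F) is claimed only when F has more than 3 elements: over F_2 no discrete curvature exists, and over F_3 only t=1 is admissible, so the action fixes every point; all other claims hold for every field. *)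

theory Defs
  imports "HOL-Analysis.Analysis"
begin

section \<open>The projective line and its group of projective transformations\<close>

definition proj_rel :: "'a::field ^ 2 \<Rightarrow> 'a ^ 2 \<Rightarrow> bool" where
  "proj_rel v w \<longleftrightarrow> v \<noteq> 0 \<and> w \<noteq> 0 \<and> (\<exists>k. k \<noteq> 0 \<and> w = k *s v)"

lemma part_equivp_proj_rel: "part_equivp (proj_rel :: 'a::field ^ 2 \<Rightarrow> _)"
proof (rule part_equivpI)
  have "proj_rel (1 :: 'a ^ 2) 1"
    unfolding proj_rel_def by (auto intro!: exI[of _ "1 :: 'a"])
  then show "\<exists>x :: 'a ^ 2. proj_rel x x" by blast
  show "symp (proj_rel :: 'a ^ 2 \<Rightarrow> _)"
  proof (rule sympI)
    fix v w :: "'a ^ 2" assume "proj_rel v w"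
    then obtain k where "v \<noteq> 0" "w \<noteq> 0" "k \<noteq> 0" "w = k *s v" unfolding proj_rel_def by blast
    then show "proj_rel w v"
      unfolding proj_rel_def
      by (auto intro!: exI[of _ "inverse k"] simp: vector_smult_assoc)
  qed
  show "transp (proj_rel :: 'a ^ 2 \<Rightarrow> _)"
  proof (rule transpI)
    fix u v w :: "'a ^ 2" assume "proj_rel u v" "proj_rel v w"
    then obtain k l where "u \<noteq> 0" "w \<noteq> 0" "k \<noteq> 0" "v = k *s u" "l \<noteq> 0" "w = l *s v"
      unfolding proj_rel_def by blast
    then show "proj_rel u w"
      unfolding proj_rel_def
      by (auto intro!: exI[of _ "l * k"] simp: vector_smult_assoc)
  qed
qed

quotient_type (overloaded) 'a proj_line = "'a::field ^ 2" / partial: proj_rel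
  by (rule part_equivp_proj_rel)

definition scale_mat :: "'a::field \<Rightarrow> 'a ^ 2 ^ 2 \<Rightarrow> 'a ^ 2 ^ 2"  (infixr "*k" 75) where
  "k *k A = (\<chi> i j. k * A $ i $ j)"

definition pgl_rel :: "'a::field ^ 2 ^ 2 \<Rightarrow> 'a ^ 2 ^ 2 \<Rightarrow> bool" where
  "pgl_rel A B \<longleftrightarrow> invertible A \<and> invertible B \<and> (\<exists>k. k \<noteq> 0 \<and> B = k *k A)"

lemma scalar_mat_assoc: "a *k (b *k (A :: 'a::field ^ 2 ^ 2)) = (a * b) *k A"
  by (simp add: vec_eq_iff scale_mat_def mult.assoc)

lemma scalar_mat_one: "1 *k (A :: 'a::field ^ 2 ^ 2) = A"
  by (simp add: vec_eq_iff scale_mat_def)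

lemma pgl_rel_one: "pgl_rel (mat 1 :: 'a::field ^ 2 ^ 2) (mat 1)"
proof -
  have "invertible (mat 1 :: 'a ^ 2 ^ 2)"
    unfolding invertible_def by (rule exI[of _ "mat 1"]) simp
  moreover have "\<exists>k. k \<noteq> 0 \<and> mat 1 = k *k (mat 1 :: 'a ^ 2 ^ 2)"
    by (rule exI[of _ 1]) (simp add: scalar_mat_one)
  ultimately show ?thesis by (simp add: pgl_rel_def)
qed

lemma part_equivp_pgl_rel: "part_equivp (pgl_rel :: 'a::field ^ 2 ^ 2 \<Rightarrow> _)"
proof (rule part_equivpI)
  show "\<exists>x :: 'a ^ 2 ^ 2. pgl_rel x x"
    using pgl_rel_one by blast
  show "symp (pgl_rel :: 'a ^ 2 ^ 2 \<Rightarrow> _)"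
  proof (rule sympI)
    fix A B :: "'a ^ 2 ^ 2" assume "pgl_rel A B"
    then obtain k where "invertible A" "invertible B" "k \<noteq> 0" "B = k *k A"
      unfolding pgl_rel_def by blast
    then show "pgl_rel B A"
      unfolding pgl_rel_def
      by (auto intro!: exI[of _ "inverse k"] simp: scalar_mat_assoc scalar_mat_one)
  qed
  show "transp (pgl_rel :: 'a ^ 2 ^ 2 \<Rightarrow> _)"
  proof (rule transpI)
    fix A B C :: "'a ^ 2 ^ 2" assume "pgl_rel A B" "pgl_rel B C"
    then obtain k l where "invertible A" "invertible C" "k \<noteq> 0" "B = k *k A" "l \<noteq> 0" "C = l *k B"
      unfolding pgl_rel_def by blast
    then show "pgl_rel A C"
      unfolding pgl_rel_def
      by (auto intro!: exI[of _ "l * k"] simp: scalar_mat_assoc)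
  qed
qed

quotient_type (overloaded) 'a pgl2 = "'a::field ^ 2 ^ 2" / partial: pgl_rel
  by (rule part_equivp_pgl_rel)

lemma scalar_mat_mult: "(k *k A) ** (l *k B) = (k * l) *k (A ** (B :: 'a::field ^ 2 ^ 2))"
  by (simp add: vec_eq_iff scale_mat_def matrix_matrix_mult_def sum_distrib_left mult_ac)

lemma scalar_mat_vec: "(k *k A) *v (l *s v) = (k * l) *s (A *v (v :: 'a::field ^ 2))"
  by (simp add: vec_eq_iff scale_mat_def matrix_vector_mult_def sum_distrib_left mult_ac)

lemma invertible_scale:
  fixes A :: "'a::field ^ 2 ^ 2"
  assumes "invertible A" "k \<noteq> 0"
  shows "invertible (k *k A)"
proof -
  obtain B where "A ** B = mat 1" "B ** A = mat 1"
    using assms unfolding invertible_def by blast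
  then have "(k *k A) ** (inverse k *k B) = mat 1" "(inverse k *k B) ** (k *k A) = mat 1"
    using assms by (simp_all add: scalar_mat_mult scalar_mat_one)
  then show ?thesis unfolding invertible_def by blast
qed

lemma invertible_matrix_inv:
  fixes A :: "'a::field ^ 2 ^ 2"
  assumes "invertible A"
  shows "A ** matrix_inv A = mat 1" "matrix_inv A ** A = mat 1" "invertible (matrix_inv A)"
proof -
  show *: "A ** matrix_inv A = mat 1" "matrix_inv A ** A = mat 1"
    using someI_ex[OF assms[unfolded invertible_def]] unfolding matrix_inv_def by auto
  show "invertible (matrix_inv A)"
    unfolding invertible_def using * by blast
qed

lemma matrix_inv_scalar:
  fixes A :: "'a::field ^ 2 ^ 2"
  assumes "invertible A" "invertible (k *k A)" "k \<noteq> 0"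
  shows "matrix_inv (k *k A) = inverse k *k matrix_inv A"
proof -
  have "(inverse k *k matrix_inv A) ** (k *k A) = mat 1"
    using assms by (simp add: scalar_mat_mult invertible_matrix_inv scalar_mat_one)
  then have "(inverse k *k matrix_inv A) ** ((k *k A) ** matrix_inv (k *k A)) = matrix_inv (k *k A)"
    by (simp add: matrix_mul_assoc)
  then show ?thesis
    using assms by (simp add: invertible_matrix_inv)
qed

lemma invertible_vec_nonzero:
  fixes A :: "'a::field ^ 2 ^ 2"
  assumes "invertible A" "v \<noteq> 0"
  shows "A *v v \<noteq> 0"
proof
  assume "A *v v = 0"
  then have "(matrix_inv A ** A) *v v = 0"
    by (simp flip: matrix_vector_mul_assoc)
  then show False using assms by (simp add: invertible_matrix_inv)
qed

lift_definition pgl_mult :: "'a::field pgl2 \<Rightarrow> 'a pgl2 \<Rightarrow> 'a pgl2" is "(**)"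
proof -
  fix A A' B B' :: "'a ^ 2 ^ 2"
  assume "pgl_rel A A'" "pgl_rel B B'"
  then obtain k l where "invertible A" "invertible A'" "invertible B" "invertible B'"
      "k \<noteq> 0" "l \<noteq> 0" "A' = k *k A" "B' = l *k B"
    unfolding pgl_rel_def by blast
  then show "pgl_rel (A ** B) (A' ** B')"
    unfolding pgl_rel_def
    by (auto intro!: exI[of _ "k * l"] simp: invertible_mult invertible_scale scalar_mat_mult)
qed

lift_definition pgl_inverse :: "'a::field pgl2 \<Rightarrow> 'a pgl2" is matrix_inv
proof -
  fix A A' :: "'a ^ 2 ^ 2"
  assume "pgl_rel A A'"
  then obtain k where "invertible A" "invertible A'" "k \<noteq> 0" "A' = k *k A"
    unfolding pgl_rel_def by blast
  then show "pgl_rel (matrix_inv A) (matrix_inv A')"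
    unfolding pgl_rel_def
    by (auto intro!: exI[of _ "inverse k"]
        simp: invertible_matrix_inv invertible_scale matrix_inv_scalar)
qed

lift_definition pgl_act :: "'a::field pgl2 \<Rightarrow> 'a proj_line \<Rightarrow> 'a proj_line" is "(*v)"
proof -
  fix A A' :: "'a ^ 2 ^ 2" and v v' :: "'a ^ 2"
  assume "pgl_rel A A'" "proj_rel v v'"
  then obtain k l where "invertible A" "invertible A'" "v \<noteq> 0" "v' \<noteq> 0"
      "k \<noteq> 0" "l \<noteq> 0" "A' = k *k A" "v' = l *s v"
    unfolding pgl_rel_def proj_rel_def by blast
  then show "proj_rel (A *v v) (A' *v v')"
    unfolding proj_rel_def
    by (intro conjI exI[of _ "k * l"]) (auto simp: invertible_vec_nonzero scalar_mat_vec
        dest: invertible_vec_nonzero)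
qed

definition det2 :: "'a::field ^ 2 \<Rightarrow> 'a ^ 2 \<Rightarrow> 'a" where
  "det2 v w = v $ 1 * w $ 2 - v $ 2 * w $ 1"

lemma det2_scale: "det2 (k *s v) (l *s w) = k * l * det2 v w"
  by (simp add: det2_def algebra_simps)

text \<open>
  The homogeneous form of $\frac{a-c}{a-d}\cdot\frac{b-d}{b-c}$; a point $x$ of the field
  corresponds to the vector $(x,1)$, and then \<open>det2\<close> is the difference. The true value lies in the
  field and is nonzero exactly if numerator and denominator are both nonzero. In all other cases
  (value $0$, value $\infty$, or three coinciding points) the term evaluates to \<open>0\<close>, by the
  convention for division by zero. An equation \<open>cross_ratio a b c d = z\<close> with \<open>z \<noteq> 0\<close> is
  therefore meant literally.
\<close>

lift_definition cross_ratio ::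
    "'a::field proj_line \<Rightarrow> 'a proj_line \<Rightarrow> 'a proj_line \<Rightarrow> 'a proj_line \<Rightarrow> 'a"
  is "\<lambda>a b c d. (det2 a c / det2 a d) * (det2 b d / det2 b c)"
proof -
  fix a a' b b' c c' d d' :: "'a ^ 2"
  assume "proj_rel a a'" "proj_rel b b'" "proj_rel c c'" "proj_rel d d'"
  then obtain k l m n where nz: "k \<noteq> 0" "l \<noteq> 0" "m \<noteq> 0" "n \<noteq> 0"
      and eq: "a' = k *s a" "b' = l *s b" "c' = m *s c" "d' = n *s d"
    unfolding proj_rel_def by blast
  have "(det2 a' c' / det2 a' d') * (det2 b' d' / det2 b' c') =
      ((k * l * m * n) * (det2 a c * det2 b d)) / ((k * l * m * n) * (det2 a d * det2 b c))"
    unfolding eq det2_scale times_divide_times_eq by (simp only: ac_simps)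
  also have "\<dots> = (det2 a c / det2 a d) * (det2 b d / det2 b c)"
    using nz by (simp only: times_divide_times_eq mult_divide_mult_cancel_left mult_eq_0_iff simp_thms)
  finally show "(det2 a c / det2 a d) * (det2 b d / det2 b c) =
      (det2 a' c' / det2 a' d') * (det2 b' d' / det2 b' c')" ..
qed

section \<open>Twisted polygons and their moduli space\<close>

type_synonym 'a polygon = "(int \<Rightarrow> 'a proj_line) \<times> 'a pgl2"

definition polygons :: "nat \<Rightarrow> 'a::field polygon set" where
  "polygons n = {(p, M).
     (\<forall>i. p (i + int n) = pgl_act M (p i)) \<and>
     (\<forall>i. p i \<noteq> p (i + 1) \<and> p (i + 1) \<noteq> p (i + 2) \<and> p i \<noteq> p (i + 2))}"

definition pgl_act_polygon :: "'a::field pgl2 \<Rightarrow> 'a polygon \<Rightarrow> 'a polygon" where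
  "pgl_act_polygon A P =
     ((\<lambda>i. pgl_act A (fst P i)), pgl_mult (pgl_mult A (snd P)) (pgl_inverse A))"

definition polygon_rel :: "nat \<Rightarrow> 'a::field polygon rel" where
  "polygon_rel n = {(P, Q). P \<in> polygons n \<and> Q \<in> polygons n \<and> (\<exists>A. Q = pgl_act_polygon A P)}"

definition polygon_class :: "nat \<Rightarrow> 'a::field polygon \<Rightarrow> 'a polygon set" where
  "polygon_class n P = polygon_rel n `` {P}"

definition moduli_space :: "nat \<Rightarrow> 'a::field polygon set set" where
  "moduli_space n = polygons n // polygon_rel n"

definition polygon_coord :: "'a::field polygon \<Rightarrow> int \<Rightarrow> 'a" where
  "polygon_coord P i =
     cross_ratio (fst P i) (fst P (i + 1)) (fst P (i - 1)) (fst P (i + 2))"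

text \<open>The coordinates \<open>polygon_coord\<close> are constant on classes (lemma \<open>class_coord_eq\<close> below).\<close>

definition class_coord :: "'a::field polygon set \<Rightarrow> int \<Rightarrow> 'a" where
  "class_coord X i = the_elem ((\<lambda>P. polygon_coord P i) ` X)"

lemma det2_mult: "det2 (A *v v) (A *v w) = det A * det2 v (w :: 'a::field ^ 2)"
  by (simp add: det2_def det_2 matrix_vector_mult_def sum_2 algebra_simps)

lemma cross_ratio_pgl_act:
  "cross_ratio (pgl_act A a) (pgl_act A b) (pgl_act A c) (pgl_act A d) = cross_ratio a b c d"
proof (transfer, goal_cases)
  case (1 A a b c d)
  then have "det A \<noteq> 0" by (simp add: pgl_rel_def invertible_det_nz)
  then show ?case by (simp add: det2_mult)
qed

lift_definition pgl_one :: "'a::field pgl2" is "mat 1"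
  by (rule pgl_rel_one)

lemma pgl_act_polygon_one: "pgl_act_polygon pgl_one P = (P :: 'a::field polygon)"
proof -
  have inv1: "invertible (mat 1 :: 'a ^ 2 ^ 2)"
    unfolding invertible_def by (rule exI[of _ "mat 1"]) simp
  have inv_mat: "matrix_inv (mat 1 :: 'a ^ 2 ^ 2) = mat 1"
    using invertible_matrix_inv(1)[OF inv1] by simp
  have act: "pgl_act pgl_one p = p" for p :: "'a proj_line"
    by transfer simp
  have mult: "pgl_mult (pgl_mult pgl_one M) (pgl_inverse pgl_one) = M" for M :: "'a pgl2"
    by transfer (simp add: inv_mat)
  show ?thesis
    by (simp add: pgl_act_polygon_def act mult)
qed

lemma class_coord_eq:
  assumes "P \<in> polygons n"
  shows "class_coord (polygon_class n P) i = polygon_coord P i"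
proof -
  have "\<exists>A. P = pgl_act_polygon A P"
    by (rule exI[of _ pgl_one]) (rule pgl_act_polygon_one[symmetric])
  then have "P \<in> polygon_class n P"
    using assms unfolding polygon_class_def polygon_rel_def by blast
  moreover have "polygon_coord Q i = polygon_coord P i" if Q: "Q \<in> polygon_class n P" for Q
  proof -
    obtain A where "Q = pgl_act_polygon A P"
      using Q unfolding polygon_class_def polygon_rel_def by blast
    then show ?thesis
      by (simp add: polygon_coord_def pgl_act_polygon_def cross_ratio_pgl_act)
  qed
  ultimately have "(\<lambda>P. polygon_coord P i) ` polygon_class n P = {polygon_coord P i}" by blast
  then show ?thesis by (simp add: class_coord_def)
qed

section \<open>Flat cross-ratio dynamics\<close>

definition curvatures :: "nat \<Rightarrow> (int \<Rightarrow> 'a::field) set" where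
  "curvatures n = {\<alpha>. (\<forall>i. \<alpha> (i + int n) = \<alpha> i) \<and> (\<forall>i. \<alpha> i \<noteq> 0 \<and> \<alpha> i \<noteq> 1)}"

definition alpha_related :: "nat \<Rightarrow> (int \<Rightarrow> 'a::field) \<Rightarrow> 'a polygon \<Rightarrow> 'a polygon \<Rightarrow> bool" where
  "alpha_related n \<alpha> P Q \<longleftrightarrow>
     \<alpha> \<in> curvatures n \<and> P \<in> polygons n \<and> Q \<in> polygons n \<and> snd P = snd Q \<and>
     (\<forall>i. cross_ratio (fst P i) (fst P (i + 1)) (fst Q i) (fst Q (i + 1)) = \<alpha> i)"

section \<open>Scaling symmetries\<close>

type_synonym 'a state = "'a polygon set \<times> (int \<Rightarrow> 'a)"

definition states :: "nat \<Rightarrow> 'a::field state set" where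
  "states n = moduli_space n \<times> curvatures n"

text \<open>
  A partially defined action of the multiplicative group on \<open>S\<close>; \<open>None\<close> means undefined. Only
  \<open>t \<noteq> 0\<close> and points of \<open>S\<close> matter. In the third clause both sides may be undefined, but only
  simultaneously: this is forced by invertibility of the group elements.
\<close>

definition partial_Gm_action :: "'s set \<Rightarrow> ('a::field \<Rightarrow> 's \<Rightarrow> 's option) \<Rightarrow> bool" where
  "partial_Gm_action S \<rho> \<longleftrightarrow>
     (\<forall>x\<in>S. \<rho> 1 x = Some x) \<and>
     (\<forall>t x y. t \<noteq> 0 \<longrightarrow> x \<in> S \<longrightarrow> \<rho> t x = Some y \<longrightarrow> y \<in> S) \<and>
     (\<forall>s t x y. s \<noteq> 0 \<longrightarrow> t \<noteq> 0 \<longrightarrow> x \<in> S \<longrightarrow> \<rho> t x = Some y \<longrightarrow> \<rho> s y = \<rho> (s * t) x) \<and>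
     (\<forall>x\<in>S. finite {t. t \<noteq> 0 \<and> \<rho> t x = None})"

text \<open>
  The cross-ratio coordinates embed the moduli space into affine space, so that an action of the
  algebraic group is one whose components are quotients of polynomials in $t$, the $c_i$ and the
  $\alpha_i$, with denominators that do not vanish where the action is defined.
\<close>

inductive polynomial_fun :: "('a::field \<Rightarrow> 'a state \<Rightarrow> 'a) \<Rightarrow> bool" where
  poly_const: "polynomial_fun (\<lambda>t x. k)"
| poly_time: "polynomial_fun (\<lambda>t x. t)"
| poly_coord: "polynomial_fun (\<lambda>t x. class_coord (fst x) i)"
| poly_curv: "polynomial_fun (\<lambda>t x. snd x i)"
| poly_add: "polynomial_fun f \<Longrightarrow> polynomial_fun g \<Longrightarrow> polynomial_fun (\<lambda>t x. f t x + g t x)"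
| poly_mult: "polynomial_fun f \<Longrightarrow> polynomial_fun g \<Longrightarrow> polynomial_fun (\<lambda>t x. f t x * g t x)"

definition rational_where_defined ::
    "nat \<Rightarrow> ('a::field \<Rightarrow> 'a state \<Rightarrow> 'a state option) \<Rightarrow> ('a state \<Rightarrow> 'a) \<Rightarrow> bool" where
  "rational_where_defined n \<rho> h \<longleftrightarrow>
     (\<exists>f g. polynomial_fun f \<and> polynomial_fun g \<and>
        (\<forall>t x y. t \<noteq> 0 \<longrightarrow> x \<in> states n \<longrightarrow> \<rho> t x = Some y \<longrightarrow>
           g t x \<noteq> 0 \<and> h y = f t x / g t x))"

definition algebraic_Gm_action :: "nat \<Rightarrow> ('a::field \<Rightarrow> 'a state \<Rightarrow> 'a state option) \<Rightarrow> bool" where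
  "algebraic_Gm_action n \<rho> \<longleftrightarrow>
     partial_Gm_action (states n) \<rho> \<and>
     (\<forall>i. rational_where_defined n \<rho> (\<lambda>y. class_coord (fst y) i)) \<and>
     (\<forall>i. rational_where_defined n \<rho> (\<lambda>y. snd y i))"

definition commutes_with_dynamics :: "nat \<Rightarrow> ('a::field \<Rightarrow> 'a state \<Rightarrow> 'a state option) \<Rightarrow> bool" where
  "commutes_with_dynamics n \<rho> \<longleftrightarrow>
     (\<forall>\<alpha> P Q t X \<beta> Y \<gamma>.
        alpha_related n \<alpha> P Q \<longrightarrow> t \<noteq> 0 \<longrightarrow>
        \<rho> t (polygon_class n P, \<alpha>) = Some (X, \<beta>) \<longrightarrow>
        \<rho> t (polygon_class n Q, \<alpha>) = Some (Y, \<gamma>) \<longrightarrow>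
        \<gamma> = \<beta> \<and> (\<exists>P'\<in>X. \<exists>Q'\<in>Y. alpha_related n \<beta> P' Q'))"

text \<open>
  Non-triviality is a statement about points over the given field. Over a field with two elements
  there is no discrete curvature at all, and over a field with three elements the only admissible
  one is $\alpha_i=2$, so that no action on points moves the curvature; the points of a non-trivial
  action of the algebraic group may then all be fixed.
\<close>

definition nontrivial_action :: "nat \<Rightarrow> ('a::field \<Rightarrow> 'a state \<Rightarrow> 'a state option) \<Rightarrow> bool" where
  "nontrivial_action n \<rho> \<longleftrightarrow>
     (\<exists>t x y. t \<noteq> 0 \<and> x \<in> states n \<and> \<rho> t x = Some y \<and> y \<noteq> x)"

definition scaling_symmetry :: "nat \<Rightarrow> ('a::field \<Rightarrow> 'a state \<Rightarrow> 'a state option) \<Rightarrow> bool" where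
  "scaling_symmetry n \<rho> \<longleftrightarrow>
     algebraic_Gm_action n \<rho> \<and> commutes_with_dynamics n \<rho> \<and> nontrivial_action n \<rho>"

end

theory Submission
  imports Defs
begin

text \<open>
  Lift the vertices of a polygon $P$ to vectors $v_i\in F^2$. The lengths of the $v_i$ can be
  adjusted so that the three-term relation between consecutive vectors becomes the discrete Hill
  equation $v_{i+2}=v_{i+1}-c_iv_i$, and its coefficients are then the cross-ratio coordinates of $P$
  (\<open>polygon_lift\<close>, \<open>hill_polygon_coord\<close>). The solutions of a Hill equation whose
  consecutive vectors are independent form one orbit of $\mathrm{GL}_2$. So a class in the moduli space is the set of all polygons with given coordinates
  (\<open>polygon_class_eq\<close>), and every $n$-periodic sequence without zeros is the coordinate sequence of a
  class (\<open>moduli_point_coord\<close>). Thus the formulas for $c_i(t)$ and $\alpha_i(t)$ define a map on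
  states. They satisfy the group law because $\alpha_1(t)=t\alpha_1$ and because the $\kappa_i$ do not
  change with $t$.

  The reason why this map commutes with the dynamics is as follows. A polygon $Q$ with the same
  monodromy as $P$ and with $q_i\neq p_i,p_{i+1}$ can be written $q_i=[v_i-u_iv_{i+1}]$ with an
  $n$-periodic $u$ without zeros, and $Q$ is $\alpha$-related to $P$ if and only if $u$ solves the
  Riccati recursion
  $$u_{i+1}-1=\frac{c_i}{\alpha_i}\,u_iu_{i+1}.$$
  Only the quotients $c_i/\alpha_i$ enter here, and the deformation keeps them. So the same $u$ gives a
  polygon $Q_t$ that is $\alpha(t)$-related to $P_t$.

  It remains to see that the coordinates of $Q$ are deformed by the same rule as those of $P$. By
  \<open>companion_coord\<close>, the coordinate of $Q$ at $i$ is $\alpha_i$ times an expression in $u$ and the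
  numbers $1-\alpha_j$ that is homogeneous of degree $0$ in the latter. The deformation multiplies all
  $1-\alpha_j$ by the common factor $\frac{t\alpha_1-1}{\alpha_1-1}$, hence it multiplies that coordinate by
  $\alpha_i(t)/\alpha_i$.
\<close>

section \<open>Homogeneous coordinates\<close>

definition pt :: "'a::field ^ 2 \<Rightarrow> 'a proj_line" where
  "pt v = abs_proj_line v"

lemma proj_rel_refl: "v \<noteq> 0 \<Longrightarrow> proj_rel v (v :: 'a::field ^ 2)"
  unfolding proj_rel_def by (auto intro!: exI[of _ 1])

lemma pgl_rel_refl: "invertible A \<Longrightarrow> pgl_rel A (A :: 'a::field ^ 2 ^ 2)"
  unfolding pgl_rel_def by (auto intro!: exI[of _ 1] simp: scalar_mat_one)

lemma pt_cases: obtains v where "v \<noteq> 0" "p = pt v"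
  by (metis Quotient_proj_line Quotient_def pt_def proj_rel_def)

lemma pgl_cases: obtains A where "invertible A" "M = abs_pgl2 A"
  by (metis Quotient_pgl2 Quotient_def pgl_rel_def)

lemma vec2_eq_iff: "v = w \<longleftrightarrow> v $ 1 = w $ 1 \<and> v $ 2 = (w :: 'a ^ 2) $ 2"
  by (simp add: vec_eq_iff forall_2)

lemma cramer2: "det2 a b *s x = det2 x b *s a + det2 a x *s (b :: 'a::field ^ 2)"
  by (simp add: vec2_eq_iff det2_def algebra_simps)

lemma det2_swap: "det2 w v = - det2 v (w :: 'a::field ^ 2)"
  by (simp add: det2_def)

lemma pt_eq_rel_iff:
  assumes "v \<noteq> 0" "w \<noteq> 0"
  shows "pt v = pt w \<longleftrightarrow> proj_rel v w"
  unfolding pt_def using Quotient_rel[OF Quotient_proj_line, of v w] assms by (simp add: proj_rel_refl)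

lemma pt_eq_iff:
  assumes "v \<noteq> 0" "w \<noteq> 0"
  shows "pt v = pt w \<longleftrightarrow> det2 v w = 0"
proof -
  have "pt v = pt w \<longleftrightarrow> proj_rel v w"
    using assms by (rule pt_eq_rel_iff)
  also have "\<dots> \<longleftrightarrow> det2 v w = 0"
  proof
    assume "det2 v w = 0"
    define k where "k = (if v $ 1 \<noteq> 0 then w $ 1 / v $ 1 else w $ 2 / v $ 2)"
    have "w = k *s v"
      using \<open>det2 v w = 0\<close> assms
      by (auto simp: k_def vec2_eq_iff det2_def field_simps)
    then show "proj_rel v w"
      using assms unfolding proj_rel_def by auto
  qed (auto simp: proj_rel_def det2_def algebra_simps)
  finally show ?thesis .
qed

lemma pt_scale: "k \<noteq> 0 \<Longrightarrow> v \<noteq> 0 \<Longrightarrow> pt (k *s v) = pt (v :: 'a::field ^ 2)"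
  by (subst pt_eq_iff) (auto simp: vec2_eq_iff det2_def)

lemma cross_ratio_pt:
  assumes "a \<noteq> 0" "b \<noteq> 0" "c \<noteq> 0" "d \<noteq> 0"
  shows "cross_ratio (pt a) (pt b) (pt c) (pt d) = (det2 a c / det2 a d) * (det2 b d / det2 b c)"
  unfolding pt_def using assms by (intro cross_ratio.abs_eq proj_rel_refl)

lemma pgl_act_pt: "invertible A \<Longrightarrow> v \<noteq> 0 \<Longrightarrow> pgl_act (abs_pgl2 A) (pt v) = pt (A *v v)"
  unfolding pt_def by (intro pgl_act.abs_eq proj_rel_refl pgl_rel_refl)

text \<open>
  The entries of \<open>A\<close> come from Cramer's rule:
  $Ax=\bigl(\det(x,b)\,a'+\det(a,x)\,b'\bigr)/\det(a,b)$.
\<close>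

lemma ex_matrix:
  fixes a b :: "'a::field ^ 2"
  assumes "det2 a b \<noteq> 0" "det2 a' b' \<noteq> 0"
  obtains A where "invertible A" "A *v a = a'" "A *v b = b'"
proof
  define A :: "'a ^ 2 ^ 2" where
    "A = (\<chi> i j. inverse (det2 a b) *
        (if j = 1 then b $ 2 * a' $ i - a $ 2 * b' $ i else a $ 1 * b' $ i - b $ 1 * a' $ i))"
  have A: "(A *v x) $ i = inverse (det2 a b) * (det2 x b * a' $ i + det2 a x * b' $ i)" for x i
    unfolding A_def by (simp add: matrix_vector_mult_def sum_2 det2_def[of x] det2_def[of _ x]
        algebra_simps)
  have zero: "det2 a a = 0" "det2 b b = 0"
    by (simp_all add: det2_def)
  show Aa: "A *v a = a'" and Ab: "A *v b = b'"
    using assms(1) by (simp_all add: vec_eq_iff A zero)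
  have "det A * det2 a b = det2 a' b'"
    using det2_mult[of A a b] Aa Ab by simp
  then show "invertible A"
    using assms(2) by (auto simp: invertible_det_nz)
qed

lemma matrix_eq_on_basis:
  fixes a b :: "'a::field ^ 2"
  assumes "det2 a b \<noteq> 0" "A *v a = B *v a" "A *v b = B *v b"
  shows "A = B"
proof -
  have "det2 a b *s (A *v x) = det2 a b *s (B *v x)" for x
    using assms(2,3) unfolding vector_scalar_commute[symmetric] cramer2[of a b x]
    by (simp add: matrix_vector_right_distrib vector_scalar_commute)
  then have "A *v x = B *v x" for x
    using assms(1) by (simp add: vec_eq_iff)
  then show ?thesis
    by (simp add: matrix_eq)
qed

section \<open>Sequences indexed by the integers\<close>

text \<open>
  Recursion over all integers: the value at \<open>0\<close> extends backwards because each step is onto. The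
  carrier \<open>S\<close> allows steps that are invertible on a part of the type only.
\<close>

lemma bi_infinite_orbit:
  fixes f :: "int \<Rightarrow> 'b \<Rightarrow> 'b"
  assumes onto: "\<And>i. f i ` S = S" and "a \<in> S"
  obtains x where "x 0 = a" "\<And>i. x i \<in> S" "\<And>i. x (i + 1) = f i (x i)"
proof -
  define y where "y = rec_nat a (\<lambda>k. f (int k))"
  define z where "z = rec_nat a (\<lambda>k. inv_into S (f (- int k - 1)))"
  have y: "y k \<in> S" for k
    using assms by (induction k) (auto simp: y_def)
  have z: "z k \<in> S" for k
    using assms by (induction k) (auto simp: z_def intro: inv_into_into)
  have y_step: "y (Suc k) = f (int k) (y k)" for k
    by (simp add: y_def)
  have z_step: "f (- int k - 1) (z (Suc k)) = z k" for k
    using z[of k] onto[of "- int k - 1"] by (simp add: z_def f_inv_into_f)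
  define x where "x i = (if i \<ge> 0 then y (nat i) else z (nat (- i)))" for i
  have "x (i + 1) = f i (x i)" for i
  proof (cases "i \<ge> 0")
    case True
    then show ?thesis
      using y_step[of "nat i"] by (simp add: x_def nat_add_distrib)
  next
    case False
    define k where "k = nat (- i - 1)"
    have "i = - int k - 1" "nat (- i) = Suc k"
      using False by (auto simp: k_def)
    moreover have "x (- int k) = z k"
      by (cases "k = 0") (auto simp: x_def y_def z_def)
    ultimately show ?thesis
      using False z_step[of k] by (simp add: x_def)
  qed
  moreover have "x 0 = a"
    by (simp add: x_def y_def)
  moreover have "x i \<in> S" for i
    using y z by (simp add: x_def)
  ultimately show ?thesis
    using that by blast
qed


lemma periodic_finite_range:
  fixes f :: "int \<Rightarrow> 'b"
  assumes "n > 0" "\<And>i. f (i + int n) = f i"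
  shows "finite (range f)"
proof -
  have shift: "f (i + int n * int k) = f i" for i k
  proof (induction k)
    case (Suc k)
    have "f (i + int n * int (Suc k)) = f (i + int n * int k + int n)"
      by (simp add: algebra_simps)
    then show ?case
      using Suc assms(2) by simp
  qed simp
  have "f i \<in> f ` {0..<int n}" for i
  proof -
    have "f i = f (i mod int n)"
    proof (cases "i div int n \<ge> 0")
      case True
      then show ?thesis
        using shift[of "i mod int n" "nat (i div int n)"] by simp
    next
      case False
      then show ?thesis
        using shift[of i "nat (- (i div int n))"] by (simp add: minus_mult_div_eq_mod)
    qed
    then show ?thesis
      using assms(1) by (intro image_eqI[of _ _ "i mod int n"]) auto
  qed
  then show ?thesis
    by (intro finite_subset[of "range f" "f ` {0..<int n}"]) auto
qed

section \<open>Polygons as solutions of a discrete Hill equation\<close>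

text \<open>
  Consecutive vectors are required to be independent; by \<open>hill_det_step\<close> this makes the
  coefficients nonzero, and the discrete analogue of the Wronskian is multiplied by \<open>c i\<close> in each step.
\<close>

definition hill :: "(int \<Rightarrow> 'a::field) \<Rightarrow> (int \<Rightarrow> 'a ^ 2) \<Rightarrow> bool" where
  "hill c v \<longleftrightarrow> (\<forall>i. v (i + 2) = v (i + 1) - c i *s v i) \<and> (\<forall>i. det2 (v i) (v (i + 1)) \<noteq> 0)"

lemma hill_step: "hill c v \<Longrightarrow> v (i + 2) = v (i + 1) - c i *s v i"
  by (simp add: hill_def)

lemma hill_det: "hill c v \<Longrightarrow> det2 (v i) (v (i + 1)) \<noteq> 0"
  by (simp add: hill_def)

lemma hill_nonzero: "hill c v \<Longrightarrow> v i \<noteq> 0"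
  using hill_det[of c v i] by (auto simp: det2_def)

lemma hill_det_step:
  assumes "hill c v"
  shows "det2 (v (i + 1)) (v (i + 2)) = c i * det2 (v i) (v (i + 1))"
    and "det2 (v i) (v (i + 2)) = det2 (v i) (v (i + 1))"
  unfolding hill_step[OF assms] by (simp_all add: det2_def algebra_simps)

lemma hill_coeff_nonzero: "hill c v \<Longrightarrow> c i \<noteq> 0"
  using hill_det_step(1)[of c v i] hill_det[of c v "i + 1"] by (auto simp: add.assoc)

lemma hill_polygon_coord:
  assumes "hill c v"
  shows "polygon_coord (\<lambda>i. pt (v i), M) i = c i"
proof -
  define d where "d = det2 (v (i - 1)) (v i)"
  define e where "e = det2 (v i) (v (i + 1))"
  have "d \<noteq> 0" "e \<noteq> 0"
    using hill_det[OF assms, of "i - 1"] hill_det[OF assms, of i] by (simp_all add: d_def e_def)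
  have "polygon_coord (\<lambda>i. pt (v i), M) i =
      (det2 (v i) (v (i - 1)) / det2 (v i) (v (i + 2))) *
      (det2 (v (i + 1)) (v (i + 2)) / det2 (v (i + 1)) (v (i - 1)))"
    by (simp add: polygon_coord_def cross_ratio_pt hill_nonzero[OF assms])
  also have "det2 (v (i + 1)) (v (i - 1)) = - d"
    using hill_det_step(2)[OF assms, of "i - 1"] by (simp add: d_def det2_swap[of "v (i + 1)" "v (i - 1)"])
      (simp add: add.commute)
  also have "det2 (v i) (v (i - 1)) = - d"
    by (simp add: d_def det2_def)
  also have "det2 (v i) (v (i + 2)) = e"
    by (simp add: e_def hill_det_step(2)[OF assms])
  also have "det2 (v (i + 1)) (v (i + 2)) = c i * e"
    by (simp add: e_def hill_det_step(1)[OF assms])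
  finally show ?thesis
    using \<open>d \<noteq> 0\<close> \<open>e \<noteq> 0\<close> by simp
qed

text \<open>
  A step $(x,y)\mapsto(y,y-c_ix)$ is invertible on pairs of independent vectors, so a solution extends
  in both directions from any initial pair.
\<close>

lemma hill_exists:
  assumes "\<And>i. c i \<noteq> 0"
  obtains v where "hill c v"
proof -
  define S :: "(('a ^ 2) \<times> ('a ^ 2)) set" where "S = {(x, y). det2 x y \<noteq> 0}"
  define f where "f i xy = (snd xy, snd xy - c i *s fst xy)" for i and xy :: "('a ^ 2) \<times> ('a ^ 2)"
  have "f i ` S = S" for i
  proof
    show "f i ` S \<subseteq> S"
      using assms by (auto simp: S_def f_def det2_def algebra_simps)
    show "S \<subseteq> f i ` S"
    proof (rule subsetI)
      fix yz assume "yz \<in> S"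
      define x where "x = inverse (c i) *s (fst yz - snd yz)"
      have "fst yz - c i *s x = snd yz"
        using assms[of i] by (simp add: x_def vector_smult_assoc)
      then have f: "f i (x, fst yz) = yz"
        by (simp add: f_def)
      have "det2 x (fst yz) = inverse (c i) * det2 (fst yz) (snd yz)"
        by (simp add: x_def det2_def algebra_simps)
      then have "(x, fst yz) \<in> S"
        using assms[of i] \<open>yz \<in> S\<close> by (simp add: S_def case_prod_unfold)
      then show "yz \<in> f i ` S"
        using f by (metis imageI)
    qed
  qed
  moreover have "(axis 1 1, axis 2 1) \<in> S"
    by (simp add: S_def det2_def axis_def)
  ultimately obtain z where z: "\<And>i. z i \<in> S" "\<And>i. z (i + 1) = f i (z i)"
    using bi_infinite_orbit[of f S] by metis
  have "hill c (\<lambda>i. fst (z i))"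
    unfolding hill_def
  proof (intro conjI allI)
    fix i
    have "fst (z (i + 2)) = snd (z (i + 1))"
      using z(2)[of "i + 1"] by (simp add: f_def add.assoc)
    then show "fst (z (i + 2)) = fst (z (i + 1)) - c i *s fst (z i)"
      by (simp add: z(2) f_def)
    show "det2 (fst (z i)) (fst (z (i + 1))) \<noteq> 0"
      using z(1)[of i] by (auto simp: z(2) f_def S_def)
  qed
  then show ?thesis
    using that by blast
qed

text \<open>
  A solution is determined by two consecutive vectors, and a matrix takes any independent pair to any
  other.
\<close>

lemma hill_unique:
  assumes "hill c v" "hill c w"
  obtains A where "invertible A" "\<And>i. A *v v i = w i"
proof -
  obtain A where A: "invertible A" "A *v v 0 = w 0" "A *v v 1 = w 1"
    using ex_matrix[of "v 0" "v 1" "w 0" "w 1"] hill_det[of c _ 0] assms by auto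
  have step: "A *v v (i + 2) = A *v v (i + 1) - c i *s (A *v v i)" for i
    by (simp add: hill_step[OF assms(1)] matrix_vector_mult_diff_distrib vector_scalar_commute)
  have "A *v v i = w i \<and> A *v v (i + 1) = w (i + 1)" for i
  proof (induction i rule: int_induct[where k = 0])
    case base
    then show ?case using A by simp
  next
    case (step1 i)
    then show ?case
      using step[of i] hill_step[OF assms(2), of i] by (simp add: add.assoc)
  next
    case (step2 i)
    have "i - 1 + 2 = i + 1" "i - 1 + 1 = i"
      by simp_all
    then have "w i - c (i - 1) *s (A *v v (i - 1)) = w i - c (i - 1) *s w (i - 1)"
      using step[of "i - 1"] hill_step[OF assms(2), of "i - 1"] step2.IH by metis
    then have "A *v v (i - 1) = w (i - 1)"
      using hill_coeff_nonzero[OF assms(1), of "i - 1"] by simp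
    then show ?case using step2.IH by simp
  qed
  then show ?thesis
    using that A(1) by blast
qed

text \<open>
  With periodic coefficients, the shifted sequence solves the same equation, so \<open>hill_unique\<close> gives
  the monodromy.
\<close>

lemma hill_monodromy:
  assumes "hill c v" "\<And>i. c (i + int n) = c i"
  obtains A where "invertible A" "\<And>i. A *v v i = v (i + int n)"
proof -
  have "hill c (\<lambda>i. v (i + int n))"
    unfolding hill_def
  proof (intro conjI allI)
    fix i
    show "v (i + 2 + int n) = v (i + 1 + int n) - c i *s v (i + int n)"
      using hill_step[OF assms(1), of "i + int n"] by (simp add: assms(2) ac_simps)
    show "det2 (v (i + int n)) (v (i + 1 + int n)) \<noteq> 0"
      using hill_det[OF assms(1), of "i + int n"] by (simp add: ac_simps)
  qed
  then show ?thesis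
    using hill_unique[OF assms(1)] that by blast
qed

lemma polygonsI:
  assumes "\<And>i. pgl_act M (p i) = p (i + int n)"
    and "\<And>i. p i \<noteq> p (i + 1)" "\<And>i. p i \<noteq> p (i + 2)"
  shows "(p, M) \<in> polygons n"
  unfolding polygons_def
proof (clarify, intro conjI allI)
  fix i
  show "p (i + 1) \<noteq> p (i + 2)"
    using assms(2)[of "i + 1"] by (simp add: add.assoc)
qed (simp_all add: assms)

lemma hill_polygon:
  assumes "hill c v" "invertible A" "\<And>i. A *v v i = v (i + int n)"
  shows "(\<lambda>i. pt (v i), abs_pgl2 A) \<in> polygons n"
proof (rule polygonsI)
  fix i
  show "pgl_act (abs_pgl2 A) (pt (v i)) = pt (v (i + int n))"
    by (simp add: pgl_act_pt assms hill_nonzero[OF assms(1)])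
  show "pt (v i) \<noteq> pt (v (i + 1))" "pt (v i) \<noteq> pt (v (i + 2))"
    using hill_det[OF assms(1)]
    by (simp_all add: pt_eq_iff hill_nonzero[OF assms(1)] hill_det_step(2)[OF assms(1)])
qed

lemma polygon_coord_periodic:
  assumes "P \<in> polygons n"
  shows "polygon_coord P (i + int n) = polygon_coord P i"
proof -
  have "fst P (i + int n) = pgl_act (snd P) (fst P i)" for i
    using assms by (auto simp: polygons_def)
  from this[of i] this[of "i + 1"] this[of "i - 1"] this[of "i + 2"] show ?thesis
    unfolding polygon_coord_def by (simp add: cross_ratio_pgl_act algebra_simps)
qed

text \<open>
  For an arbitrary lift $w$ of the vertices, $w_{i+2}=a_iw_{i+1}-b_iw_i$ with $a_i,b_i\neq0$, because
  three consecutive vertices are distinct. Rescaling $v_i=l_iw_i$ with $l_{i+2}=l_{i+1}/a_i$ turns the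
  coefficient of $v_{i+1}$ into $1$.
\<close>

lemma polygon_lift:
  assumes P: "P \<in> polygons n"
  obtains v where "hill (polygon_coord P) v" "fst P = (\<lambda>i. pt (v i))"
proof -
  have "\<exists>w. \<forall>i. w i \<noteq> 0 \<and> fst P i = pt (w i)"
    by (intro choice allI) (metis pt_cases)
  then obtain w where w: "\<And>i. w i \<noteq> 0" "\<And>i. fst P i = pt (w i)"
    by blast
  have distinct: "fst P i \<noteq> fst P (i + 1)" "fst P (i + 1) \<noteq> fst P (i + 2)"
      "fst P i \<noteq> fst P (i + 2)" for i
    using P by (auto simp: polygons_def)
  have det: "det2 (w i) (w (i + 1)) \<noteq> 0" "det2 (w (i + 1)) (w (i + 2)) \<noteq> 0"
      "det2 (w i) (w (i + 2)) \<noteq> 0" for i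
    using distinct[of i] by (simp_all add: w pt_eq_iff)
  define a where "a i = det2 (w i) (w (i + 2)) / det2 (w i) (w (i + 1))" for i
  define b where "b i = det2 (w (i + 1)) (w (i + 2)) / det2 (w i) (w (i + 1))" for i
  have ab: "a i \<noteq> 0" "b i \<noteq> 0" for i
    using det[of i] by (simp_all add: a_def b_def)
  have "det2 (w i) (w (i + 1)) *s w (i + 2) =
      det2 (w i) (w (i + 1)) *s (a i *s w (i + 1) - b i *s w i)" for i
    unfolding cramer2[of "w i" "w (i + 1)" "w (i + 2)"]
    using det[of i] det2_swap[of "w (i + 2)" "w (i + 1)"]
    by (simp add: a_def b_def vector_smult_assoc vector_ssub_ldistrib)
  then have rec: "w (i + 2) = a i *s w (i + 1) - b i *s w i" for i
    using det[of i] vector_mul_lcancel by blast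
  have "(\<lambda>x. x / a (i - 1)) ` (- {0}) = - {0}" for i
  proof -
    have "x \<in> (\<lambda>x. x / a (i - 1)) ` (- {0})" if "x \<noteq> 0" for x
      using ab(1)[of "i - 1"] that by (intro image_eqI[of _ _ "x * a (i - 1)"]) auto
    then show ?thesis
      using ab(1)[of "i - 1"] by auto
  qed
  then obtain l where l: "\<And>i. l i \<noteq> 0" "\<And>i. l (i + 1) = l i / a (i - 1)"
    using bi_infinite_orbit[of "\<lambda>i x. x / a (i - 1)" "- {0}" 1]
    by (metis ComplD ComplI insertCI singletonD zero_neq_one)
  define v where "v i = l i *s w i" for i
  define c where "c i = l (i + 2) * b i / l i" for i
  have "hill c v"
    unfolding hill_def
  proof (intro conjI allI)
    fix i
    have "l (i + 2) * a i = l (i + 1)"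
      using l(2)[of "i + 1"] ab(1)[of i] by (simp add: add.assoc)
    then show "v (i + 2) = v (i + 1) - c i *s v i"
      using l(1)[of i]
      by (simp add: v_def c_def rec[of i] vector_smult_assoc vector_ssub_ldistrib)
    show "det2 (v i) (v (i + 1)) \<noteq> 0"
      using det[of i] l(1) by (simp add: v_def det2_scale)
  qed
  moreover have points: "fst P = (\<lambda>i. pt (v i))"
    using w l(1) by (auto simp: v_def pt_scale)
  moreover have "polygon_coord P = c"
    using hill_polygon_coord[OF \<open>hill c v\<close>, of "snd P"] points by (metis ext prod.collapse)
  ultimately show ?thesis
    using that by simp
qed

text \<open>
  The monodromy of a polygon is determined by its vertices: a matrix \<open>B\<close> that represents it agrees with
  \<open>A\<close> on each $v_i$ up to a factor $k_i$, and the Hill equation between $v_0,v_1,v_2$ forces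
  $k_0=k_1=k_2$, so that \<open>B\<close> is a multiple of \<open>A\<close>.
\<close>

lemma polygon_monodromy:
  assumes P: "P \<in> polygons n" "fst P = (\<lambda>i. pt (v i))"
    and v: "hill c v" and A: "invertible A" "\<And>i. A *v v i = v (i + int n)"
  shows "snd P = abs_pgl2 A"
proof -
  obtain B where B: "invertible B" "snd P = abs_pgl2 B"
    by (rule pgl_cases)
  have "\<exists>k. k \<noteq> 0 \<and> B *v v i = k *s (A *v v i)" for i
  proof -
    have "pt (B *v v i) = pt (v (i + int n))"
      using P B hill_nonzero[OF v] by (auto simp: polygons_def pgl_act_pt)
    then have "proj_rel (v (i + int n)) (B *v v i)"
      using B(1) hill_nonzero[OF v] by (subst pt_eq_rel_iff[symmetric]) (auto dest: invertible_vec_nonzero)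
    then show ?thesis
      by (auto simp: proj_rel_def A)
  qed
  then obtain k where k: "\<And>i. k i \<noteq> 0" "\<And>i. B *v v i = k i *s (A *v v i)"
    by metis
  have "B *v v 2 = B *v v 1 - c 0 *s (B *v v 0)" and "A *v v 2 = A *v v 1 - c 0 *s (A *v v 0)"
    using hill_step[OF v, of 0] by (simp_all add: matrix_vector_mult_diff_distrib vector_scalar_commute)
  then have "k 2 *s (A *v v 1 - c 0 *s (A *v v 0)) = k 1 *s (A *v v 1) - c 0 *s (k 0 *s (A *v v 0))"
    by (simp add: k)
  then have "k 2 *s (v (1 + int n) - c 0 *s v (int n)) = k 1 *s v (1 + int n) - c 0 *s (k 0 *s v (int n))"
    by (simp add: A(2))
  \<comment> \<open>Compare the coefficients of the independent vectors $v_n$ and $v_{n+1}$.\<close>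
  from arg_cong[OF this, of "\<lambda>x. det2 x (v (1 + int n))"] arg_cong[OF this, of "det2 (v (int n))"]
  have "k 2 * c 0 * det2 (v (int n)) (v (1 + int n)) = k 0 * c 0 * det2 (v (int n)) (v (1 + int n))"
    and "k 2 * det2 (v (int n)) (v (1 + int n)) = k 1 * det2 (v (int n)) (v (1 + int n))"
    by (simp_all add: det2_def algebra_simps)
  then have "k 0 = k 1"
    using hill_det[OF v, of "int n"] hill_coeff_nonzero[OF v, of 0] by (simp add: add.commute)
  have scaled: "(l *k A) *v x = l *s (A *v x)" for l x
    using scalar_mat_vec[of l A 1 x] by simp
  have "B = k 0 *k A"
    by (rule matrix_eq_on_basis[of "v 0" "v 1"])
      (use hill_det[OF v, of 0] k(2)[of 0] k(2)[of 1] \<open>k 0 = k 1\<close> in \<open>simp_all add: scaled\<close>)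
  then have "pgl_rel A B"
    using A B k(1)[of 0] unfolding pgl_rel_def by blast
  then show ?thesis
    unfolding B(2) by (metis Quotient_pgl2 Quotient_rel)
qed

section \<open>The moduli space in cross-ratio coordinates\<close>

text \<open>
  The cross-ratio coordinates are a complete invariant: lifts of two polygons with equal coordinates
  solve the same Hill equation, so a matrix \<open>A\<close> takes one lift to the other, and conjugation by \<open>A\<close>
  takes the monodromy to the other one by \<open>polygon_monodromy\<close>.
\<close>

lemma polygon_class_eq:
  assumes P: "P \<in> polygons n"
  shows "polygon_class n P = {Q \<in> polygons n. polygon_coord Q = polygon_coord P}"
proof (intro equalityI subsetI)
  fix Q assume "Q \<in> polygon_class n P"
  then obtain A where "Q \<in> polygons n" "Q = pgl_act_polygon A P"
    by (auto simp: polygon_class_def polygon_rel_def)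
  then show "Q \<in> {Q \<in> polygons n. polygon_coord Q = polygon_coord P}"
    by (auto simp: polygon_coord_def pgl_act_polygon_def cross_ratio_pgl_act)
next
  fix Q assume "Q \<in> {Q \<in> polygons n. polygon_coord Q = polygon_coord P}"
  then have Q: "Q \<in> polygons n" "polygon_coord Q = polygon_coord P"
    by auto
  define c where "c = polygon_coord P"
  obtain v where v: "hill c v" "fst P = (\<lambda>i. pt (v i))"
    using polygon_lift[OF P] unfolding c_def by blast
  obtain w where w: "hill c w" "fst Q = (\<lambda>i. pt (w i))"
    using polygon_lift[OF Q(1)] unfolding c_def Q(2) by blast
  have "c (i + int n) = c i" for i
    using polygon_coord_periodic[OF P] by (simp add: c_def)
  then obtain B where B: "invertible B" "\<And>i. B *v v i = v (i + int n)"
    using hill_monodromy[OF v(1)] by blast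
  obtain A where A: "invertible A" "\<And>i. A *v v i = w i"
    using hill_unique[OF v(1) w(1)] by blast
  have A_inv: "matrix_inv A *v w i = v i" for i
    using A by (metis invertible_matrix_inv(2) matrix_vector_mul_assoc matrix_vector_mul_lid)
  define D where "D = A ** B ** matrix_inv A"
  have "invertible D" and "D *v w i = w (i + int n)" for i
    using A B by (simp_all add: D_def invertible_mult invertible_matrix_inv A_inv
        flip: matrix_vector_mul_assoc)
  then have "snd Q = abs_pgl2 D"
    using polygon_monodromy[OF Q(1) w(2,1)] by blast
  also have "\<dots> = pgl_mult (pgl_mult (abs_pgl2 A) (snd P)) (pgl_inverse (abs_pgl2 A))"
    using polygon_monodromy[OF P v(2,1) B] A(1) B(1)
    by (simp add: D_def pgl_mult.abs_eq pgl_inverse.abs_eq pgl_rel_refl invertible_mult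
        invertible_matrix_inv)
  finally have "Q = pgl_act_polygon (abs_pgl2 A) P"
    using v(2) w(2) A hill_nonzero[OF v(1)]
    by (simp add: pgl_act_polygon_def prod_eq_iff pgl_act_pt)
  then show "Q \<in> polygon_class n P"
    using P Q by (auto simp: polygon_class_def polygon_rel_def)
qed


definition moduli_point :: "nat \<Rightarrow> (int \<Rightarrow> 'a::field) \<Rightarrow> 'a polygon set" where
  "moduli_point n c = {P \<in> polygons n. polygon_coord P = c}"

lemma moduli_space_coord:
  assumes "X \<in> moduli_space n"
  shows "X = moduli_point n (class_coord X)" "class_coord X i \<noteq> 0"
    "class_coord X (i + int n) = class_coord X i"
proof -
  obtain P where P: "P \<in> polygons n" "X = polygon_class n P"
    using assms by (auto simp: moduli_space_def quotient_def polygon_class_def)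
  then have coord: "class_coord X = polygon_coord P"
    by (simp add: fun_eq_iff class_coord_eq)
  show "X = moduli_point n (class_coord X)"
    unfolding coord unfolding P(2) moduli_point_def by (rule polygon_class_eq[OF P(1)])
  show "class_coord X i \<noteq> 0"
    using polygon_lift[OF P(1)] hill_coeff_nonzero unfolding coord by metis
  show "class_coord X (i + int n) = class_coord X i"
    unfolding coord by (rule polygon_coord_periodic[OF P(1)])
qed

lemma moduli_point_coord:
  assumes "\<And>i. c i \<noteq> 0" "\<And>i. c (i + int n) = c i"
  shows "moduli_point n c \<in> moduli_space n" "class_coord (moduli_point n c) = c"
proof -
  obtain v where v: "hill c v"
    using hill_exists[of c] assms(1) by blast
  obtain A where A: "invertible A" "\<And>i. A *v v i = v (i + int n)"
    using hill_monodromy[OF v assms(2)] by blast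
  define P where "P = (\<lambda>i. pt (v i), abs_pgl2 A)"
  have P: "P \<in> polygons n" "polygon_coord P = c"
    using hill_polygon[OF v A] hill_polygon_coord[OF v] by (auto simp: P_def)
  then have X: "moduli_point n c = polygon_class n P"
    by (simp add: polygon_class_eq moduli_point_def)
  show "moduli_point n c \<in> moduli_space n"
    unfolding X using P(1) by (auto simp: moduli_space_def polygon_class_def intro: quotientI)
  show "class_coord (moduli_point n c) = c"
    unfolding X using P by (simp add: fun_eq_iff class_coord_eq)
qed

section \<open>Related polygons and the Riccati recursion\<close>

text \<open>
  Up to scaling, this is every vector $w$ that is a multiple neither of $v_i$ nor of $v_{i+1}$, when
  \<open>u i\<close> runs through the nonzero scalars.
\<close>

definition companion :: "(int \<Rightarrow> 'a::field ^ 2) \<Rightarrow> (int \<Rightarrow> 'a) \<Rightarrow> int \<Rightarrow> 'a ^ 2" where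
  "companion v u i = v i - u i *s v (i + 1)"

definition riccati :: "(int \<Rightarrow> 'a::field) \<Rightarrow> (int \<Rightarrow> 'a) \<Rightarrow> (int \<Rightarrow> 'a) \<Rightarrow> bool" where
  "riccati c \<alpha> u \<longleftrightarrow> (\<forall>i. \<alpha> i * (u (i + 1) - 1) = c i * u i * u (i + 1))"

lemma companion_nonzero:
  assumes "hill c v"
  shows "companion v u i \<noteq> 0"
proof -
  have "det2 (companion v u i) (v (i + 1)) = det2 (v i) (v (i + 1))"
    by (simp add: companion_def det2_def algebra_simps)
  then show ?thesis
    using hill_det[OF assms, of i] by (auto simp: det2_def)
qed

text \<open>
  The cross-ratio condition says that $q_{i+1}=[v_i-\frac{u_i}{a}v_{i+1}]$, because the parameter $u$
  is a projective coordinate that vanishes at $p_i$ and is infinite at $p_{i+1}$. Comparison with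
  $q_{i+1}=[v_{i+1}-u_{i+1}v_{i+2}]$ by means of the Hill equation gives the Riccati step.
\<close>

lemma companion_cross_ratio:
  assumes v: "hill c v" and u: "u i \<noteq> 0" "u (i + 1) \<noteq> 0" and "a \<noteq> 0"
  shows "cross_ratio (pt (v i)) (pt (v (i + 1)))
            (pt (companion v u i)) (pt (companion v u (i + 1))) = a
         \<longleftrightarrow> a * (u (i + 1) - 1) = c i * u i * u (i + 1)"
proof -
  define d where "d = det2 (v i) (v (i + 1))"
  have d: "d \<noteq> 0"
    using hill_det[OF v] by (simp add: d_def)
  have next_step: "companion v u (i + 1) = v (i + 1) - u (i + 1) *s (v (i + 1) - c i *s v i)"
    using hill_step[OF v, of i] by (simp add: companion_def add.assoc)
  have dets: "det2 (v i) (companion v u i) = - u i * d"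
      "det2 (v (i + 1)) (companion v u i) = - d"
      "det2 (v i) (companion v u (i + 1)) = (1 - u (i + 1)) * d"
      "det2 (v (i + 1)) (companion v u (i + 1)) = - c i * u (i + 1) * d"
    unfolding next_step by (simp_all add: d_def companion_def det2_def algebra_simps)
  have "cross_ratio (pt (v i)) (pt (v (i + 1))) (pt (companion v u i)) (pt (companion v u (i + 1)))
      = - (c i * u i * u (i + 1)) / (1 - u (i + 1))"
    using d by (simp add: cross_ratio_pt hill_nonzero[OF v] companion_nonzero[OF v] dets)
  also have "\<dots> = (c i * u i * u (i + 1)) / (u (i + 1) - 1)"
    by (metis minus_diff_eq minus_divide_divide)
  finally have "cross_ratio (pt (v i)) (pt (v (i + 1))) (pt (companion v u i))
      (pt (companion v u (i + 1))) = (c i * u i * u (i + 1)) / (u (i + 1) - 1)" .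
  moreover have "c i * u i * u (i + 1) \<noteq> 0"
    using u hill_coeff_nonzero[OF v] by simp
  ultimately show ?thesis
    using \<open>a \<noteq> 0\<close> by (cases "u (i + 1) = 1") (auto simp: nonzero_divide_eq_eq)
qed

lemma riccati_step:
  assumes "riccati c \<alpha> u"
  shows "c i * u i * u (i + 1) = \<alpha> i * (u (i + 1) - 1)"
  using assms by (simp add: riccati_def)

text \<open>
  The recursion at $i-1$ would make $0$ equal to a product of nonzero factors.
\<close>

lemma riccati_ne_1:
  assumes "riccati c \<alpha> u" "\<And>i. c i \<noteq> 0" "\<And>i. u i \<noteq> 0"
  shows "u i \<noteq> 1"
  using riccati_step[OF assms(1), of "i - 1"] assms(2)[of "i - 1"] assms(3) by auto

text \<open>
  The recursion removes the coefficient \<open>c\<close>: what is left depends on the curvature only through the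
  factor $1-\alpha_i$.
\<close>

lemma companion_det_neighbour:
  assumes v: "hill c v" and r: "riccati c \<alpha> u"
  shows "det2 (companion v u i) (companion v u (i + 1)) =
           (1 - \<alpha> i) * (1 - u (i + 1)) * det2 (v i) (v (i + 1))"
proof -
  have next_step: "companion v u (i + 1) = v (i + 1) - u (i + 1) *s (v (i + 1) - c i *s v i)"
    using hill_step[OF v, of i] by (simp add: companion_def add.assoc)
  have "det2 (companion v u i) (companion v u (i + 1)) =
      (1 - u (i + 1) + c i * u i * u (i + 1)) * det2 (v i) (v (i + 1))"
    unfolding next_step by (simp add: companion_def det2_def algebra_simps)
  then show ?thesis
    unfolding riccati_step[OF r] by (simp add: algebra_simps)
qed

text \<open>
  For a solution $u$ of the recursion without zeros, this vanishes exactly if $q_i=q_{i+2}$, by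
  \<open>companion_det_skip\<close>. What matters is that it is linear in $1-\alpha_i$ and $1-\alpha_{i+1}$.
\<close>

definition skip_factor :: "(int \<Rightarrow> 'a::field) \<Rightarrow> (int \<Rightarrow> 'a) \<Rightarrow> int \<Rightarrow> 'a" where
  "skip_factor \<alpha> u i = (1 - \<alpha> (i + 1)) - (1 - \<alpha> i) * (1 - u (i + 1))"

lemma companion_det_skip:
  assumes v: "hill c v" and r: "riccati c \<alpha> u"
  shows "u (i + 1) * det2 (companion v u i) (companion v u (i + 2)) =
           (1 - u (i + 2)) * skip_factor \<alpha> u i * det2 (v i) (v (i + 1))"
proof -
  have "v (i + 2 + 1) = v (i + 2) - c (i + 1) *s v (i + 1)"
    using hill_step[OF v, of "i + 1"] by (simp add: add.assoc)
  then have skip: "companion v u (i + 2) = (v (i + 1) - c i *s v i) -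
      u (i + 2) *s ((v (i + 1) - c i *s v i) - c (i + 1) *s v (i + 1))"
    using hill_step[OF v, of i] by (simp add: companion_def)
  have expand: "u (i + 1) * det2 (companion v u i) (companion v u (i + 2)) =
      (u (i + 1) * (1 - u (i + 2)) + c (i + 1) * u (i + 1) * u (i + 2)
        - c i * u i * u (i + 1) * (1 - u (i + 2))) * det2 (v i) (v (i + 1))"
    unfolding skip by (simp add: companion_def det2_def algebra_simps)
  have later: "c (i + 1) * u (i + 1) * u (i + 2) = \<alpha> (i + 1) * (u (i + 2) - 1)"
    using riccati_step[OF r, of "i + 1"] by (simp add: add.assoc)
  show ?thesis
    unfolding expand later riccati_step[OF r, of i] by (simp add: skip_factor_def algebra_simps)
qed

text \<open>
  The fraction behind $-\alpha_i$ contains \<open>u\<close> and the numbers $1-\alpha_j$ only, and it is homogeneous of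
  degree $0$ in these. The factor $\alpha_i$ comes from the ratio
  $c_i=\det(v_{i+1},v_{i+2})/\det(v_i,v_{i+1})$, which the recursion expresses by $\alpha_i$ and $u$.
\<close>

lemma companion_coord:
  assumes v: "hill c v" and r: "riccati c \<alpha> u" and u: "\<And>i. u i \<noteq> 0"
    and skip: "\<And>i. skip_factor \<alpha> u i \<noteq> 0"
  shows "polygon_coord (\<lambda>i. pt (companion v u i), M) i =
           - \<alpha> i * ((1 - \<alpha> (i - 1)) * (1 - \<alpha> (i + 1)) * (1 - u i)
              / (skip_factor \<alpha> u (i - 1) * skip_factor \<alpha> u i))"
proof -
  define q where "q = companion v u"
  define d where "d i = det2 (v i) (v (i + 1))" for i
  have d: "d i \<noteq> 0" "d (i + 1) = c i * d i" for i
    using hill_det[OF v] hill_det_step(1)[OF v] by (simp_all add: d_def add.assoc)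
  define x where "x i = 1 - u i" for i
  have x: "x i \<noteq> 0" for i
    using riccati_ne_1[OF r hill_coeff_nonzero[OF v] u] by (simp add: x_def)
  have D: "det2 (q i) (q (i + 1)) = (1 - \<alpha> i) * x (i + 1) * d i" for i
    by (simp add: q_def d_def x_def companion_det_neighbour[OF v r])
  have E: "det2 (q i) (q (i + 2)) = x (i + 2) * skip_factor \<alpha> u i * d i / u (i + 1)" for i
    using companion_det_skip[OF v r, of i] u[of "i + 1"] by (simp add: q_def d_def x_def field_simps)
  have c: "c i = - \<alpha> i * x (i + 1) / (u i * u (i + 1))"
    using riccati_step[OF r, of i] u by (simp add: x_def nonzero_eq_divide_eq algebra_simps)
  have "polygon_coord (\<lambda>i. pt (q i), M) i =
      (det2 (q i) (q (i - 1)) / det2 (q i) (q (i + 2))) *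
      (det2 (q (i + 1)) (q (i + 2)) / det2 (q (i + 1)) (q (i - 1)))"
    by (simp add: polygon_coord_def cross_ratio_pt companion_nonzero[OF v] q_def)
  also have "det2 (q i) (q (i - 1)) = - ((1 - \<alpha> (i - 1)) * x i * d (i - 1))"
    using D[of "i - 1"] det2_swap[of "q i" "q (i - 1)"] by simp
  also have "det2 (q (i + 1)) (q (i + 2)) = (1 - \<alpha> (i + 1)) * x (i + 2) * (c i * d i)"
    using D[of "i + 1"] by (simp add: d(2) add.assoc)
  also have "det2 (q (i + 1)) (q (i - 1)) =
      - (x (i + 1) * skip_factor \<alpha> u (i - 1) * d (i - 1) / u i)"
    using E[of "i - 1"] det2_swap[of "q (i + 1)" "q (i - 1)"] by (simp add: add.commute)
  finally show ?thesis
    unfolding q_def[symmetric] x_def[symmetric] E c using d(1) u x skip by (simp add: ac_simps)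
qed

text \<open>
  A cross-ratio $[p_i,p_{i+1},q_i,q_{i+1}]\neq0$ keeps $q_i$ away from $p_i$ and $p_{i+1}$, so that $u_i$
  exists and is nonzero. As the monodromy of $P$ shifts the vectors $v_i$ by $n$ and is that of $Q$, the
  sequence $u$ is periodic.
\<close>

lemma alpha_related_companion:
  assumes rel: "alpha_related n \<alpha> P Q"
    and v: "hill (polygon_coord P) v" "fst P = (\<lambda>i. pt (v i))"
  obtains u where "\<And>i. u i \<noteq> 0" "\<And>i. u (i + int n) = u i"
    "riccati (polygon_coord P) \<alpha> u" "fst Q = (\<lambda>i. pt (companion v u i))"
proof -
  have \<alpha>: "\<alpha> i \<noteq> 0" for i
    using rel by (auto simp: alpha_related_def curvatures_def)
  have P: "P \<in> polygons n" and Q: "Q \<in> polygons n" "snd P = snd Q"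
    using rel by (auto simp: alpha_related_def)
  have cr: "cross_ratio (pt (v i)) (pt (v (i + 1))) (fst Q i) (fst Q (i + 1)) = \<alpha> i" for i
    using rel by (simp add: alpha_related_def v)
  have "\<exists>w. \<forall>i. w i \<noteq> 0 \<and> fst Q i = pt (w i)"
    by (intro choice allI) (metis pt_cases)
  then obtain w where w: "\<And>i. w i \<noteq> 0" "\<And>i. fst Q i = pt (w i)"
    by blast
  have det: "det2 (v i) (w i) \<noteq> 0" "det2 (v (i + 1)) (w i) \<noteq> 0" for i
    using cr[of i] \<alpha>[of i] by (auto simp: w cross_ratio_pt hill_nonzero[OF v(1)])
  \<comment> \<open>The zero of $u\mapsto\det(w_i,v_i-u\,v_{i+1})$.\<close>
  define u where "u i = det2 (v i) (w i) / det2 (v (i + 1)) (w i)" for i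
  have u: "u i \<noteq> 0" for i
    using det by (simp add: u_def)
  have pts: "fst Q i = pt (companion v u i)" for i
  proof -
    have "det2 (v (i + 1)) (w i) * det2 (w i) (companion v u i) =
        det2 (v (i + 1)) (w i) * det2 (w i) (v i) - det2 (v i) (w i) * det2 (w i) (v (i + 1))"
      using det[of i] by (simp add: companion_def u_def det2_def[of "w i"] algebra_simps)
    also have "\<dots> = 0"
      by (simp add: det2_def algebra_simps)
    finally show ?thesis
      using det[of i] by (simp add: w pt_eq_iff companion_nonzero[OF v(1)])
  qed
  have "riccati (polygon_coord P) \<alpha> u"
    unfolding riccati_def
    using companion_cross_ratio[OF v(1) u u \<alpha>] cr by (simp add: pts)
  moreover have "u (i + int n) = u i" for i
  proof -
    obtain A where A: "invertible A" "\<And>i. A *v v i = v (i + int n)"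
      using hill_monodromy[OF v(1) polygon_coord_periodic[OF P]] by blast
    have "A *v companion v u i = v (i + int n) - u i *s v (i + int n + 1)"
      using A(2)[of i] A(2)[of "i + 1"]
      by (simp add: companion_def matrix_vector_mult_diff_distrib vector_scalar_commute ac_simps)
    moreover have "snd Q = abs_pgl2 A"
      using polygon_monodromy[OF P v(2,1) A] Q by simp
    then have "pt (companion v u (i + int n)) = pt (A *v companion v u i)"
      using Q A(1) pts companion_nonzero[OF v(1)] by (auto simp: polygons_def pgl_act_pt)
    ultimately have "det2 (companion v u (i + int n)) (v (i + int n) - u i *s v (i + int n + 1)) = 0"
      by (metis A(1) companion_nonzero invertible_vec_nonzero pt_eq_iff v(1))
    then have "(u (i + int n) - u i) * det2 (v (i + int n)) (v (i + int n + 1)) = 0"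
      by (simp add: companion_def det2_def algebra_simps)
    then show ?thesis
      using hill_det[OF v(1), of "i + int n"] by simp
  qed
  ultimately show ?thesis
    using that u pts by blast
qed

text \<open>
  The matrix that shifts $v$ by $n$ also shifts the companion, as $u$ is periodic; so the two polygons
  share their monodromy. The recursion and the nonvanishing skip factors keep three consecutive
  companion vertices distinct.
\<close>

lemma companion_alpha_related:
  assumes \<alpha>: "\<alpha> \<in> curvatures n" and v: "hill c v" "\<And>i. c (i + int n) = c i"
    and u: "\<And>i. u i \<noteq> 0" "\<And>i. u (i + int n) = u i"
    and r: "riccati c \<alpha> u" and skip: "\<And>i. skip_factor \<alpha> u i \<noteq> 0"
  obtains M where
    "alpha_related n \<alpha> (\<lambda>i. pt (v i), M) (\<lambda>i. pt (companion v u i), M)"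
proof -
  have \<alpha>_ne: "\<alpha> i \<noteq> 0" "\<alpha> i \<noteq> 1" for i
    using \<alpha> by (auto simp: curvatures_def)
  have u1: "u i \<noteq> 1" for i
    using riccati_ne_1[OF r hill_coeff_nonzero[OF v(1)] u(1)] .
  obtain A where A: "invertible A" "\<And>i. A *v v i = v (i + int n)"
    using hill_monodromy[OF v] by blast
  have "(\<lambda>i. pt (companion v u i), abs_pgl2 A) \<in> polygons n"
  proof (rule polygonsI)
    fix i
    have "A *v companion v u i = companion v u (i + int n)"
      using A(2)[of i] A(2)[of "i + 1"]
      by (simp add: companion_def matrix_vector_mult_diff_distrib vector_scalar_commute u(2) ac_simps)
    then show "pgl_act (abs_pgl2 A) (pt (companion v u i)) = pt (companion v u (i + int n))"
      by (simp add: pgl_act_pt A companion_nonzero[OF v(1)])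
    show "pt (companion v u i) \<noteq> pt (companion v u (i + 1))"
      using \<alpha>_ne[of i] u1[of "i + 1"] hill_det[OF v(1), of i]
      by (simp add: pt_eq_iff companion_nonzero[OF v(1)] companion_det_neighbour[OF v(1) r])
    have "u (i + 1) * det2 (companion v u i) (companion v u (i + 2)) \<noteq> 0"
      using u1[of "i + 2"] skip[of i] hill_det[OF v(1), of i]
      by (simp add: companion_det_skip[OF v(1) r])
    then show "pt (companion v u i) \<noteq> pt (companion v u (i + 2))"
      by (simp add: pt_eq_iff companion_nonzero[OF v(1)])
  qed
  moreover have "cross_ratio (pt (v i)) (pt (v (i + 1)))
      (pt (companion v u i)) (pt (companion v u (i + 1))) = \<alpha> i" for i
    using r by (subst companion_cross_ratio[OF v(1) u(1) u(1) \<alpha>_ne(1)]) (simp add: riccati_def)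
  ultimately have "alpha_related n \<alpha> (\<lambda>i. pt (v i), abs_pgl2 A) (\<lambda>i. pt (companion v u i), abs_pgl2 A)"
    using \<alpha> hill_polygon[OF v(1) A] by (simp add: alpha_related_def)
  then show ?thesis
    by (rule that)
qed

section \<open>Deforming a related pair\<close>

text \<open>
  The sequence \<open>u\<close> that describes \<open>Q\<close> relative to \<open>P\<close> also serves for the deformed pair, since
  $c_i/\alpha_i$ does not change. The coordinates of the new companion follow from \<open>companion_coord\<close>, where
  the powers of \<open>k\<close> cancel.
\<close>

lemma alpha_related_deform:
  assumes rel: "alpha_related n \<alpha> P Q" and \<beta>: "\<beta> \<in> curvatures n"
    and scaled: "\<And>i. 1 - \<beta> i = k * (1 - \<alpha> i)"
  obtains P' Q' where "alpha_related n \<beta> P' Q'"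
    "\<And>i. polygon_coord P' i = polygon_coord P i * (\<beta> i / \<alpha> i)"
    "\<And>i. polygon_coord Q' i = polygon_coord Q i * (\<beta> i / \<alpha> i)"
proof -
  have \<alpha>: "\<alpha> i \<noteq> 0" "\<alpha> i \<noteq> 1" "\<alpha> (i + int n) = \<alpha> i"
    and \<beta>': "\<beta> i \<noteq> 0" "\<beta> i \<noteq> 1" "\<beta> (i + int n) = \<beta> i" for i
    using rel \<beta> by (auto simp: alpha_related_def curvatures_def)
  have P: "P \<in> polygons n" and Q: "Q \<in> polygons n"
    using rel by (auto simp: alpha_related_def)
  have k: "k \<noteq> 0"
    using scaled[of 0] \<beta>'(2)[of 0] by auto
  define c where "c = polygon_coord P"
  define c' where "c' i = c i * (\<beta> i / \<alpha> i)" for i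
  obtain v where v: "hill c v" "fst P = (\<lambda>i. pt (v i))"
    using polygon_lift[OF P] unfolding c_def by blast
  obtain u where u: "\<And>i. u i \<noteq> 0" "\<And>i. u (i + int n) = u i"
      and r: "riccati c \<alpha> u" and Qu: "fst Q = (\<lambda>i. pt (companion v u i))"
    using alpha_related_companion[OF rel] v unfolding c_def by blast
  have u1: "u i \<noteq> 1" for i
    using riccati_ne_1[OF r hill_coeff_nonzero[OF v(1)] u(1)] .
  have skip: "skip_factor \<alpha> u i \<noteq> 0" for i
  proof
    assume "skip_factor \<alpha> u i = 0"
    then have "det2 (companion v u i) (companion v u (i + 2)) = 0"
      using companion_det_skip[OF v(1) r, of i] u(1) by simp
    then have "fst Q i = fst Q (i + 2)"
      by (simp add: Qu pt_eq_iff companion_nonzero[OF v(1)])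
    then show False
      using Q by (auto simp: polygons_def)
  qed
  have scaled_skip: "skip_factor \<beta> u i = k * skip_factor \<alpha> u i" for i
    unfolding skip_factor_def scaled by (simp add: algebra_simps)
  obtain v' where v': "hill c' v'"
    using hill_exists[of c'] hill_coeff_nonzero[OF v(1)] \<alpha>(1) \<beta>'(1) unfolding c'_def
    by (metis divide_eq_0_iff mult_eq_0_iff)
  have "c (i + int n) = c i" for i
    using polygon_coord_periodic[OF P] by (simp add: c_def)
  then have c'_periodic: "c' (i + int n) = c' i" for i
    by (simp add: c'_def \<alpha>(3) \<beta>'(3))
  have r': "riccati c' \<beta> u"
    unfolding riccati_def
  proof
    fix i
    have "c' i * u i * u (i + 1) = \<beta> i / \<alpha> i * (c i * u i * u (i + 1))"
      by (simp add: c'_def)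
    then show "\<beta> i * (u (i + 1) - 1) = c' i * u i * u (i + 1)"
      using \<alpha>(1)[of i] by (simp add: riccati_step[OF r])
  qed
  have skip': "skip_factor \<beta> u i \<noteq> 0" for i
    using k skip by (simp add: scaled_skip)
  obtain M where M: "alpha_related n \<beta> (\<lambda>i. pt (v' i), M) (\<lambda>i. pt (companion v' u i), M)"
    using companion_alpha_related[OF \<beta> v' c'_periodic u r' skip'] by blast
  show ?thesis
  proof (rule that[OF M])
    fix i
    show "polygon_coord (\<lambda>i. pt (v' i), M) i = polygon_coord P i * (\<beta> i / \<alpha> i)"
      by (simp add: hill_polygon_coord[OF v'] c'_def c_def)
    have "polygon_coord Q i = polygon_coord (\<lambda>i. pt (companion v u i), snd Q) i"
      using Qu by (metis prod.collapse)
    note coord_Q = this[unfolded companion_coord[OF v(1) r u(1) skip]]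
    show "polygon_coord (\<lambda>i. pt (companion v' u i), M) i = polygon_coord Q i * (\<beta> i / \<alpha> i)"
      unfolding companion_coord[OF v' r' u(1) skip'] coord_Q scaled_skip scaled
      using k \<alpha>(1)[of i] skip by simp
  qed
qed

section \<open>The scaling action\<close>

definition curvature_flow :: "'a::field \<Rightarrow> (int \<Rightarrow> 'a) \<Rightarrow> int \<Rightarrow> 'a" where
  "curvature_flow t \<alpha> i = 1 + (\<alpha> i - 1) / (\<alpha> 1 - 1) * (t * \<alpha> 1 - 1)"

definition scaling :: "nat \<Rightarrow> 'a::field \<Rightarrow> 'a state \<Rightarrow> 'a state option" where
  "scaling n t x =
     (let \<beta> = curvature_flow t (snd x) in
        if \<forall>i. \<beta> i \<noteq> 0 \<and> \<beta> i \<noteq> 1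
        then Some (moduli_point n (\<lambda>i. class_coord (fst x) i * (\<beta> i / snd x i)), \<beta>)
        else None)"

lemma scaling_eq_Some_iff:
  "scaling n t (X, \<alpha>) = Some (Y, \<beta>) \<longleftrightarrow>
     \<beta> = curvature_flow t \<alpha> \<and> (\<forall>i. \<beta> i \<noteq> 0 \<and> \<beta> i \<noteq> 1) \<and>
     Y = moduli_point n (\<lambda>i. class_coord X i * (\<beta> i / \<alpha> i))"
  by (auto simp: scaling_def Let_def)

lemma curvature_flow_1: "\<alpha> 1 \<noteq> 1 \<Longrightarrow> curvature_flow 1 \<alpha> = \<alpha>"
  by (simp add: curvature_flow_def fun_eq_iff)

lemma curvature_flow_at_1: "\<alpha> 1 \<noteq> 1 \<Longrightarrow> curvature_flow t \<alpha> 1 = t * \<alpha> 1"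
  by (simp add: curvature_flow_def)

text \<open>
  The ratios $\kappa_i$ are the same for \<open>\<alpha>\<close> and its deformation, since all $\alpha_i-1$ are multiplied by
  the same number; and the deformation multiplies $\alpha_1$ by $t$.
\<close>

lemma curvature_flow_flow:
  assumes "t * \<alpha> 1 \<noteq> 1" "\<alpha> 1 \<noteq> 1"
  shows "curvature_flow s (curvature_flow t \<alpha>) = curvature_flow (s * t) \<alpha>"
  using assms by (simp add: curvature_flow_def fun_eq_iff mult.assoc)

lemma curvature_flow_admissible_iff:
  fixes \<alpha> :: "int \<Rightarrow> 'a::field"
  assumes \<alpha>: "\<alpha> \<in> curvatures n"
  defines "\<kappa> \<equiv> \<lambda>i. (\<alpha> i - 1) / (\<alpha> 1 - 1)"
  shows "(\<forall>i. curvature_flow t \<alpha> i \<noteq> 0 \<and> curvature_flow t \<alpha> i \<noteq> 1) \<longleftrightarrow>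
     t \<noteq> 1 / \<alpha> 1 \<and> (\<forall>i. t \<noteq> (\<kappa> i - 1) / (\<kappa> i * \<alpha> 1))"
proof -
  have ne: "\<alpha> i \<noteq> 0" "\<alpha> i \<noteq> 1" for i
    using \<alpha> by (auto simp: curvatures_def)
  have \<kappa>: "\<kappa> i \<noteq> 0" for i
    using ne by (simp add: \<kappa>_def)
  have flow: "curvature_flow t \<alpha> i = 1 + \<kappa> i * (t * \<alpha> 1 - 1)" for i
    by (simp add: curvature_flow_def \<kappa>_def)
  have "curvature_flow t \<alpha> i = 1 \<longleftrightarrow> t = 1 / \<alpha> 1" for i
    using \<kappa>[of i] ne(1)[of 1] by (simp add: flow nonzero_eq_divide_eq)
  moreover have "curvature_flow t \<alpha> i = 0 \<longleftrightarrow> t = (\<kappa> i - 1) / (\<kappa> i * \<alpha> 1)" for i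
  proof -
    have "curvature_flow t \<alpha> i = t * (\<kappa> i * \<alpha> 1) - (\<kappa> i - 1)"
      by (simp add: flow algebra_simps)
    then show ?thesis
      using \<kappa>[of i] ne(1)[of 1] by (simp add: nonzero_eq_divide_eq)
  qed
  ultimately show ?thesis
    by auto
qed

lemma curvature_flow_curvatures:
  assumes "\<alpha> \<in> curvatures n" "\<forall>i. curvature_flow t \<alpha> i \<noteq> 0 \<and> curvature_flow t \<alpha> i \<noteq> 1"
  shows "curvature_flow t \<alpha> \<in> curvatures n"
  using assms by (simp add: curvatures_def curvature_flow_def)

lemma scaling_coord:
  assumes X: "X \<in> moduli_space n" and \<alpha>: "\<alpha> \<in> curvatures n"
    and def: "scaling n t (X, \<alpha>) = Some (Y, \<beta>)"
  shows "Y \<in> moduli_space n" "\<beta> \<in> curvatures n"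
    "class_coord Y i = class_coord X i * (\<beta> i / \<alpha> i)"
proof -
  have \<beta>: "\<beta> = curvature_flow t \<alpha>" "\<forall>i. \<beta> i \<noteq> 0 \<and> \<beta> i \<noteq> 1"
    and Y: "Y = moduli_point n (\<lambda>i. class_coord X i * (\<beta> i / \<alpha> i))"
    using def by (auto simp: scaling_eq_Some_iff)
  show "\<beta> \<in> curvatures n"
    using curvature_flow_curvatures[OF \<alpha>] \<beta> by simp
  then have "class_coord X i * (\<beta> i / \<alpha> i) \<noteq> 0"
      "class_coord X (i + int n) * (\<beta> (i + int n) / \<alpha> (i + int n)) = class_coord X i * (\<beta> i / \<alpha> i)" for i
    using \<alpha> moduli_space_coord(2,3)[OF X] by (simp_all add: curvatures_def)
  note new = moduli_point_coord[of "\<lambda>i. class_coord X i * (\<beta> i / \<alpha> i)", OF this]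
  show "Y \<in> moduli_space n" "class_coord Y i = class_coord X i * (\<beta> i / \<alpha> i)"
    using new by (simp_all add: Y)
qed

text \<open>
  The coordinates satisfy the group law because the quotients $\alpha_i(t)/\alpha_i$ telescope. By
  periodicity only finitely many values occur among the $\alpha_i$, so only finitely many $t$ are
  excluded.
\<close>

lemma partial_Gm_action_scaling:
  assumes "n > 0"
  shows "partial_Gm_action (states n) (scaling n :: 'a::field \<Rightarrow> _)"
  unfolding partial_Gm_action_def
proof (intro conjI ballI allI impI)
  fix x :: "'a state" assume x: "x \<in> states n"
  obtain X \<alpha> where x_eq: "x = (X, \<alpha>)" and X: "X \<in> moduli_space n" and \<alpha>: "\<alpha> \<in> curvatures n"
    using x by (auto simp: states_def)
  have ne: "\<alpha> i \<noteq> 0" "\<alpha> i \<noteq> 1" for i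
    using \<alpha> by (auto simp: curvatures_def)
  show "scaling n 1 x = Some x"
    unfolding x_eq scaling_eq_Some_iff curvature_flow_1[OF ne(2)]
    using moduli_space_coord(1)[OF X] ne by simp
  have "{t. t \<noteq> 0 \<and> scaling n t x = None} \<subseteq>
      insert (1 / \<alpha> 1) ((\<lambda>a. ((a - 1) / (\<alpha> 1 - 1) - 1) / ((a - 1) / (\<alpha> 1 - 1) * \<alpha> 1)) ` range \<alpha>)"
    using curvature_flow_admissible_iff[OF \<alpha>] by (auto simp: x_eq scaling_def Let_def)
  moreover have "finite (range \<alpha>)"
    using \<alpha> periodic_finite_range[OF assms, of \<alpha>] by (simp add: curvatures_def)
  ultimately show "finite {t. t \<noteq> 0 \<and> scaling n t x = None}"
    by (meson finite.insertI finite_imageI finite_subset)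
next
  fix t :: 'a and x y :: "'a state"
  assume "x \<in> states n" "scaling n t x = Some y"
  then show "y \<in> states n"
    using scaling_coord by (cases x, cases y) (auto simp: states_def)
next
  fix s t :: 'a and x y :: "'a state"
  assume "x \<in> states n" "scaling n t x = Some y"
  moreover obtain X \<alpha> Y \<beta> where xy: "x = (X, \<alpha>)" "y = (Y, \<beta>)"
    by (cases x, cases y)
  ultimately have X: "X \<in> moduli_space n" and \<alpha>: "\<alpha> \<in> curvatures n"
    and def: "scaling n t (X, \<alpha>) = Some (Y, \<beta>)"
    by (auto simp: states_def)
  have \<beta>: "\<beta> = curvature_flow t \<alpha>" "\<And>i. \<beta> i \<noteq> 0" "\<And>i. \<beta> i \<noteq> 1"
    using def by (auto simp: scaling_eq_Some_iff)
  have "\<alpha> 1 \<noteq> 1"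
    using \<alpha> by (auto simp: curvatures_def)
  then have "t * \<alpha> 1 \<noteq> 1"
    using \<beta>(1) \<beta>(3)[of 1] by (simp add: curvature_flow_at_1)
  then have flow: "curvature_flow s \<beta> = curvature_flow (s * t) \<alpha>"
    using curvature_flow_flow \<open>\<alpha> 1 \<noteq> 1\<close> \<beta>(1) by simp
  show "scaling n s y = scaling n (s * t) x"
    using \<beta>(2) by (simp add: scaling_def Let_def xy flow scaling_coord(3)[OF X \<alpha> def])
qed

lemma polynomial_fun_minus_1:
  assumes "polynomial_fun f"
  shows "polynomial_fun (\<lambda>t x. f t x - 1)"
  using poly_add[OF assms poly_const[of "-1"]] by simp

lemma algebraic_Gm_action_scaling:
  assumes "n > 0"
  shows "algebraic_Gm_action n (scaling n :: 'a::field \<Rightarrow> _)"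
  unfolding algebraic_Gm_action_def
proof (intro conjI allI)
  show "partial_Gm_action (states n) (scaling n :: 'a \<Rightarrow> _)"
    by (rule partial_Gm_action_scaling[OF assms])
next
  fix i
  define f :: "'a \<Rightarrow> 'a state \<Rightarrow> 'a" where
    "f = (\<lambda>t x. (snd x 1 - 1) + (snd x i - 1) * (t * snd x 1 - 1))"
  define g :: "'a \<Rightarrow> 'a state \<Rightarrow> 'a" where "g = (\<lambda>t x. snd x 1 - 1)"
  have poly: "polynomial_fun f" "polynomial_fun g"
    unfolding f_def g_def by (intro polynomial_fun_minus_1 polynomial_fun.intros)+
  have flow: "g t x \<noteq> 0 \<and> snd x i \<noteq> 0 \<and> snd y i = f t x / g t x \<and>
      class_coord (fst y) i = class_coord (fst x) i * (snd y i / snd x i)"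
    if "x \<in> states n" "scaling n t x = Some y" for t x y
  proof -
    have "\<forall>i. snd x i \<noteq> 0 \<and> snd x i \<noteq> 1"
      using that(1) by (auto simp: states_def curvatures_def)
    moreover have "snd y = curvature_flow t (snd x)"
      using that(2) by (cases x, cases y) (simp add: scaling_eq_Some_iff)
    moreover have "class_coord (fst y) i = class_coord (fst x) i * (snd y i / snd x i)"
      using that scaling_coord(3) by (cases x, cases y) (auto simp: states_def)
    ultimately show ?thesis
      by (simp add: f_def g_def curvature_flow_def add_divide_distrib)
  qed
  show "rational_where_defined n (scaling n) (\<lambda>y :: 'a state. snd y i)"
    unfolding rational_where_defined_def
    using poly flow by blast
  have "polynomial_fun (\<lambda>t x :: 'a state. class_coord (fst x) i * f t x)"
      "polynomial_fun (\<lambda>t x :: 'a state. g t x * snd x i)"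
    using poly by (intro polynomial_fun.intros; simp)+
  moreover have "g t x * snd x i \<noteq> 0 \<and>
      class_coord (fst y) i = class_coord (fst x) i * f t x / (g t x * snd x i)"
    if "x \<in> states n" "scaling n t x = Some y" for t x y
    using flow[OF that] by simp
  ultimately show "rational_where_defined n (scaling n) (\<lambda>y :: 'a state. class_coord (fst y) i)"
    unfolding rational_where_defined_def by blast
qed

lemma commutes_with_dynamics_scaling: "commutes_with_dynamics n (scaling n)"
  unfolding commutes_with_dynamics_def
proof (intro allI impI)
  fix \<alpha> :: "int \<Rightarrow> 'a" and P Q t X \<beta> Y \<gamma>
  assume rel: "alpha_related n \<alpha> P Q"
    and P: "scaling n t (polygon_class n P, \<alpha>) = Some (X, \<beta>)"
    and Q: "scaling n t (polygon_class n Q, \<alpha>) = Some (Y, \<gamma>)"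
  have \<alpha>: "\<alpha> \<in> curvatures n" and PQ: "P \<in> polygons n" "Q \<in> polygons n"
    using rel by (auto simp: alpha_related_def)
  have \<beta>: "\<beta> = curvature_flow t \<alpha>" "\<gamma> = \<beta>" "\<beta> \<in> curvatures n"
    using P Q curvature_flow_curvatures[OF \<alpha>] by (auto simp: scaling_eq_Some_iff)
  have X: "X = moduli_point n (\<lambda>i. polygon_coord P i * (\<beta> i / \<alpha> i))"
    and Y: "Y = moduli_point n (\<lambda>i. polygon_coord Q i * (\<beta> i / \<alpha> i))"
    using P Q \<beta>(2) by (simp_all add: scaling_eq_Some_iff class_coord_eq[OF PQ(1)] class_coord_eq[OF PQ(2)])
  have "1 - \<beta> i = (t * \<alpha> 1 - 1) / (\<alpha> 1 - 1) * (1 - \<alpha> i)" for i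
  proof -
    have "\<alpha> 1 - 1 \<noteq> 0"
      using \<alpha> by (auto simp: curvatures_def)
    then show ?thesis
      by (simp add: \<beta>(1) curvature_flow_def divide_simps) (simp add: algebra_simps)
  qed
  then obtain P' Q' where PQ': "alpha_related n \<beta> P' Q'"
      "\<And>i. polygon_coord P' i = polygon_coord P i * (\<beta> i / \<alpha> i)"
      "\<And>i. polygon_coord Q' i = polygon_coord Q i * (\<beta> i / \<alpha> i)"
    using alpha_related_deform[OF rel \<beta>(3)] by blast
  then have "P' \<in> X" "Q' \<in> Y"
    by (auto simp: X Y moduli_point_def alpha_related_def)
  then show "\<gamma> = \<beta> \<and> (\<exists>P'\<in>X. \<exists>Q'\<in>Y. alpha_related n \<beta> P' Q')"
    using PQ'(1) \<beta>(2) by blast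
qed

text \<open>
  With more than three elements there are two distinct constant curvatures $a$ and $b$, and $t=b/a$
  moves one to the other.
\<close>

lemma nontrivial_action_scaling:
  assumes "infinite (UNIV :: 'a::field set) \<or> card (UNIV :: 'a set) > 3"
  shows "nontrivial_action n (scaling n :: 'a \<Rightarrow> _)"
proof -
  have "\<exists>x. x \<notin> {0, 1, a}" for a :: 'a
  proof (rule ccontr)
    assume "\<nexists>x. x \<notin> {0, 1, a}"
    then have "UNIV \<subseteq> {0, 1, a}"
      by blast
    then have "finite (UNIV :: 'a set)" "card (UNIV :: 'a set) \<le> card {0, 1, a}"
      by (auto intro: finite_subset card_mono)
    moreover have "card {0, 1, a} \<le> 3"
      by (simp add: card_insert_if)
    ultimately show False
      using assms by simp
  qed
  then obtain a b :: 'a where ab: "a \<notin> {0, 1}" "b \<notin> {0, 1, a}"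
    by (metis insert_iff)
  define \<alpha> where "\<alpha> = (\<lambda>i :: int. a)"
  have \<alpha>: "\<alpha> \<in> curvatures n"
    using ab by (simp add: curvatures_def \<alpha>_def)
  have X: "moduli_point n (\<lambda>i. 1 :: 'a) \<in> moduli_space n"
    by (rule moduli_point_coord) auto
  have "curvature_flow (b / a) \<alpha> = (\<lambda>i. b)"
    using ab by (simp add: curvature_flow_def \<alpha>_def fun_eq_iff)
  then obtain Y where "scaling n (b / a) (moduli_point n (\<lambda>i. 1), \<alpha>) = Some (Y, \<lambda>i. b)"
    using ab by (auto simp: scaling_def)
  moreover have "(\<lambda>i. b) \<noteq> \<alpha>"
    using ab by (auto simp: \<alpha>_def fun_eq_iff)
  ultimately show ?thesis
    unfolding nontrivial_action_def states_def using \<alpha> X ab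
    by (intro exI[of _ "b / a"] exI[of _ "(moduli_point n (\<lambda>i. 1), \<alpha>)"] exI[of _ "(Y, \<lambda>i. b)"]) auto
qed

theorem proposition5p5:
  fixes n :: nat
  assumes "n \<ge> 3"
  shows "\<exists>\<rho> :: 'a::field \<Rightarrow> 'a state \<Rightarrow> 'a state option.
    algebraic_Gm_action n \<rho> \<and> commutes_with_dynamics n \<rho> \<and>
    (infinite (UNIV :: 'a set) \<or> card (UNIV :: 'a set) > 3 \<longrightarrow> scaling_symmetry n \<rho>) \<and>
    (\<forall>X\<in>moduli_space n. \<forall>\<alpha>\<in>curvatures n. \<forall>t. t \<noteq> 0 \<longrightarrow>
       (let \<kappa> = (\<lambda>i. (\<alpha> i - 1) / (\<alpha> 1 - 1)) in
         (\<rho> t (X, \<alpha>) \<noteq> None \<longleftrightarrow>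
            t \<noteq> 1 / \<alpha> 1 \<and> (\<forall>i. t \<noteq> (\<kappa> i - 1) / (\<kappa> i * \<alpha> 1))) \<and>
         (\<forall>Y \<beta>. \<rho> t (X, \<alpha>) = Some (Y, \<beta>) \<longrightarrow>
            (\<forall>i. \<beta> i = 1 + \<kappa> i * (t * \<alpha> 1 - 1)) \<and>
            (\<forall>i. class_coord Y i = class_coord X i * (\<beta> i / \<alpha> i)))))"
proof (intro exI[of _ "scaling n"] conjI ballI allI impI)
  show algebraic: "algebraic_Gm_action n (scaling n :: 'a \<Rightarrow> _)"
    using assms by (simp add: algebraic_Gm_action_scaling)
  show commutes: "commutes_with_dynamics n (scaling n :: 'a \<Rightarrow> _)"
    by (rule commutes_with_dynamics_scaling)
  show "scaling_symmetry n (scaling n :: 'a \<Rightarrow> _)"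
    if "infinite (UNIV :: 'a set) \<or> card (UNIV :: 'a set) > 3"
    using algebraic commutes nontrivial_action_scaling[OF that] by (simp add: scaling_symmetry_def)
next
  fix X :: "'a polygon set" and \<alpha> :: "int \<Rightarrow> 'a" and t :: 'a
  assume X: "X \<in> moduli_space n" and \<alpha>: "\<alpha> \<in> curvatures n"
  have "scaling n t (X, \<alpha>) \<noteq> None \<longleftrightarrow>
      (\<forall>i. curvature_flow t \<alpha> i \<noteq> 0 \<and> curvature_flow t \<alpha> i \<noteq> 1)"
    by (simp add: scaling_def Let_def)
  moreover have "\<beta> i = 1 + (\<alpha> i - 1) / (\<alpha> 1 - 1) * (t * \<alpha> 1 - 1)"
      "class_coord Y i = class_coord X i * (\<beta> i / \<alpha> i)"
    if "scaling n t (X, \<alpha>) = Some (Y, \<beta>)" for Y \<beta> i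
    using that scaling_coord(3)[OF X \<alpha> that] by (simp_all add: scaling_eq_Some_iff curvature_flow_def)
  ultimately show "let \<kappa> = (\<lambda>i. (\<alpha> i - 1) / (\<alpha> 1 - 1)) in
      (scaling n t (X, \<alpha>) \<noteq> None \<longleftrightarrow>
         t \<noteq> 1 / \<alpha> 1 \<and> (\<forall>i. t \<noteq> (\<kappa> i - 1) / (\<kappa> i * \<alpha> 1))) \<and>
      (\<forall>Y \<beta>. scaling n t (X, \<alpha>) = Some (Y, \<beta>) \<longrightarrow>
         (\<forall>i. \<beta> i = 1 + \<kappa> i * (t * \<alpha> 1 - 1)) \<and>
         (\<forall>i. class_coord Y i = class_coord X i * (\<beta> i / \<alpha> i)))"
    unfolding Let_def curvature_flow_admissible_iff[OF \<alpha>] by blast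
qed

end
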